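(* Let $G$ be a finitely generated group that is nilpotent of class at most $2$, and let $H$ be a subgroup of $G$. Then $$\mathrm{dom}_G^{\mathcal{A}^2\cap\mathcal{N}il}(H) = H,$$ where $\mathcal{A}^2\cap\mathcal{N}il$ is the category of all metabelian nilpotent groups.
   Context: $\mathcal{A}^2\cap\mathcal{N}il$ denotes the full subcategory of the category of groups whose objects are all groups that are both nilpotent (of arbitrary finite class) and metabelian. A group $K$ is metabelian if $[[K,K],[K,K]] = \{e\}$, equivalently if $K$ is an extension of an abelian group by an abelian group. A group $G$ is nilpotent of class at most $2$ if $[[G,G],G]=\{e\}$. For a full subcategory $\mathcal{C}$ of the category of groups that is closed under passing to subgroups, a group $G \in \mathcal{C}$ and a subgroup $H$ of $G$, the dominion of $H$ in $G$ (in the category $\mathcal{C}$) is the subgroup $$\mathrm{dom}_G^{\mathcal{C}}(H) = \{ g \in G \mid \text{for all } K \in \mathcal{C} \text{ and all group homomorphisms } f_1,f_2\colon G \to K, \text{ if } f_1|_H = f_2|_H \text{ then } f_1(g) = f_2(g)\}.$$ *)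

theory Defs
  imports "HOL-Algebra.Generated_Groups"
begin

text \<open>
  The mutual commutator subgroup \<open>[A, B]\<close>, with the same commutator convention as
  \<^const>\<open>derived\<close>, so that \<open>[H, H]\<close> is \<^term>\<open>derived G H\<close>.
\<close>

definition commutator_subgroup ::
    "('a, 'b) monoid_scheme \<Rightarrow> 'a set \<Rightarrow> 'a set \<Rightarrow> 'a set" where
  "commutator_subgroup G A B =
     generate G {a \<otimes>\<^bsub>G\<^esub> b \<otimes>\<^bsub>G\<^esub> inv\<^bsub>G\<^esub> a \<otimes>\<^bsub>G\<^esub> inv\<^bsub>G\<^esub> b | a b. a \<in> A \<and> b \<in> B}"

lemma commutator_subgroup_self: "commutator_subgroup G H H = derived G H"
  unfolding commutator_subgroup_def derived_def
  by (rule arg_cong[where f = "generate G"]) blast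

primrec lower_central :: "('a, 'b) monoid_scheme \<Rightarrow> nat \<Rightarrow> 'a set" where
  "lower_central G 0 = carrier G"
| "lower_central G (Suc n) = commutator_subgroup G (lower_central G n) (carrier G)"

definition nilpotent_class_le :: "nat \<Rightarrow> ('a, 'b) monoid_scheme \<Rightarrow> bool" where
  "nilpotent_class_le c G \<longleftrightarrow> group G \<and> lower_central G c = {\<one>\<^bsub>G\<^esub>}"

lemma nilpotent_class_le_2_iff:
  "nilpotent_class_le 2 G \<longleftrightarrow>
     group G \<and> commutator_subgroup G (derived G (carrier G)) (carrier G) = {\<one>\<^bsub>G\<^esub>}"
  by (simp add: nilpotent_class_le_def numeral_2_eq_2 commutator_subgroup_self)

definition nilpotent_group :: "('a, 'b) monoid_scheme \<Rightarrow> bool" where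
  "nilpotent_group G \<longleftrightarrow> (\<exists>c. nilpotent_class_le c G)"

definition metabelian_group :: "('a, 'b) monoid_scheme \<Rightarrow> bool" where
  "metabelian_group G \<longleftrightarrow> group G \<and> derived G (derived G (carrier G)) = {\<one>\<^bsub>G\<^esub>}"

definition metabelian_nilpotent :: "('a, 'b) monoid_scheme \<Rightarrow> bool" where
  "metabelian_nilpotent G \<longleftrightarrow> metabelian_group G \<and> nilpotent_group G"

definition finitely_generated_group :: "('a, 'b) monoid_scheme \<Rightarrow> bool" where
  "finitely_generated_group G \<longleftrightarrow>
     group G \<and> (\<exists>S. finite S \<and> S \<subseteq> carrier G \<and> generate G S = carrier G)"

text \<open>
  A definition cannot quantify over the carrier type of the test group \<open>K\<close>.  Given
  \<open>f\<^sub>1, f\<^sub>2 : G \<rightarrow> K\<close>, only the subgroup of \<open>K\<close> generated by the two images matters; its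
  elements are values of words in two copies of \<open>G\<close>, so it has an isomorphic copy with
  carrier in \<^typ>\<open>('a + 'a) list\<close>.  For a class closed under subgroups and isomorphisms,
  test groups on this one type therefore give the same dominion as test groups on all types;
  \<open>dominion_metabelian_nilpotentD\<close> below proves this for the metabelian nilpotent groups.
\<close>

definition dominion ::
    "(('a + 'a) list monoid \<Rightarrow> bool) \<Rightarrow> ('a, 'b) monoid_scheme \<Rightarrow> 'a set \<Rightarrow> 'a set" where
  "dominion \<C> G H =
     {g \<in> carrier G. \<forall>K. \<C> K \<longrightarrow>
        (\<forall>f\<^sub>1 \<in> hom G K. \<forall>f\<^sub>2 \<in> hom G K.
           (\<forall>h \<in> H. f\<^sub>1 h = f\<^sub>2 h) \<longrightarrow> f\<^sub>1 g = f\<^sub>2 g)}"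

lemma commutator_subgroup_hom_image:
  assumes "group G" "group K" "\<phi> \<in> hom G K" "A \<subseteq> carrier G" "B \<subseteq> carrier G"
  shows "\<phi> ` commutator_subgroup G A B = commutator_subgroup K (\<phi> ` A) (\<phi> ` B)"
proof -
  interpret group_hom G K \<phi>
    using assms by (simp add: group_hom_def group_hom_axioms_def)
  let ?S = "{a \<otimes>\<^bsub>G\<^esub> b \<otimes>\<^bsub>G\<^esub> inv\<^bsub>G\<^esub> a \<otimes>\<^bsub>G\<^esub> inv\<^bsub>G\<^esub> b | a b. a \<in> A \<and> b \<in> B}"
  let ?T = "{a \<otimes>\<^bsub>K\<^esub> b \<otimes>\<^bsub>K\<^esub> inv\<^bsub>K\<^esub> a \<otimes>\<^bsub>K\<^esub> inv\<^bsub>K\<^esub> b | a b. a \<in> \<phi> ` A \<and> b \<in> \<phi> ` B}"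
  have S: "?S \<subseteq> carrier G" using assms(4,5) by blast
  have c: "\<phi> (a \<otimes>\<^bsub>G\<^esub> b \<otimes>\<^bsub>G\<^esub> inv\<^bsub>G\<^esub> a \<otimes>\<^bsub>G\<^esub> inv\<^bsub>G\<^esub> b) =
      \<phi> a \<otimes>\<^bsub>K\<^esub> \<phi> b \<otimes>\<^bsub>K\<^esub> inv\<^bsub>K\<^esub> \<phi> a \<otimes>\<^bsub>K\<^esub> inv\<^bsub>K\<^esub> \<phi> b" if "a \<in> A" "b \<in> B" for a b
    using that assms(4,5) by (simp add: subset_iff)
  have "\<phi> ` ?S = ?T"
  proof
    show "\<phi> ` ?S \<subseteq> ?T" using c by fastforce
    show "?T \<subseteq> \<phi> ` ?S"
    proof
      fix x assume "x \<in> ?T"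
      then obtain a b where ab: "a \<in> A" "b \<in> B"
        "x = \<phi> a \<otimes>\<^bsub>K\<^esub> \<phi> b \<otimes>\<^bsub>K\<^esub> inv\<^bsub>K\<^esub> \<phi> a \<otimes>\<^bsub>K\<^esub> inv\<^bsub>K\<^esub> \<phi> b" by blast
      then have "x = \<phi> (a \<otimes>\<^bsub>G\<^esub> b \<otimes>\<^bsub>G\<^esub> inv\<^bsub>G\<^esub> a \<otimes>\<^bsub>G\<^esub> inv\<^bsub>G\<^esub> b)" using c by simp
      then show "x \<in> \<phi> ` ?S" using ab by blast
    qed
  qed
  then show ?thesis
    unfolding commutator_subgroup_def using generate_img[OF S] by simp
qed

lemma commutator_subgroup_mono:
  assumes "group G" "A \<subseteq> A'" "B \<subseteq> B'"
  shows "commutator_subgroup G A B \<subseteq> commutator_subgroup G A' B'"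
  unfolding commutator_subgroup_def
  by (rule group.mono_generate[OF assms(1)]) (use assms(2,3) in blast)

lemma commutator_subgroup_subgroup:
  assumes "group G" "A \<subseteq> carrier G" "B \<subseteq> carrier G"
  shows "subgroup (commutator_subgroup G A B) G"
proof -
  interpret group G by fact
  show ?thesis
    unfolding commutator_subgroup_def
    by (rule generate_is_subgroup) (use assms(2,3) in blast)
qed

lemma lower_central_subgroup:
  assumes "group G" shows "subgroup (lower_central G n) G"
proof (induction n)
  case 0
  then show ?case using group.subgroup_self[OF assms] by simp
next
  case (Suc n)
  then show ?case
    using commutator_subgroup_subgroup[OF assms subgroup.subset[OF Suc] subset_refl] by simp
qed

lemma lower_central_hom_image:
  assumes "group G" "group K" "\<phi> \<in> hom G K"
  shows "\<phi> ` lower_central G n \<subseteq> lower_central K n"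
proof (induction n)
  case 0
  then show ?case using assms(3) by (auto simp: hom_def)
next
  case (Suc n)
  have "\<phi> ` lower_central G (Suc n) =
      commutator_subgroup K (\<phi> ` lower_central G n) (\<phi> ` carrier G)"
    using commutator_subgroup_hom_image[OF assms]
      subgroup.subset[OF lower_central_subgroup[OF assms(1)]] by simp
  also have "\<dots> \<subseteq> lower_central K (Suc n)"
    unfolding lower_central.simps
    by (rule commutator_subgroup_mono[OF assms(2) Suc]) (use assms(3) in \<open>auto simp: hom_def\<close>)
  finally show ?case .
qed

lemma metabelian_nilpotent_inj_hom:
  assumes "group G" "metabelian_nilpotent K" "\<phi> \<in> hom G K" "inj_on \<phi> (carrier G)"
  shows "metabelian_nilpotent G"
proof -
  have K: "group K" using assms(2) by (simp add: metabelian_nilpotent_def metabelian_group_def)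
  interpret group_hom G K \<phi>
    using assms K by (simp add: group_hom_def group_hom_axioms_def)
  have triv: "N = {\<one>\<^bsub>G\<^esub>}" if N: "subgroup N G" "\<phi> ` N \<subseteq> {\<one>\<^bsub>K\<^esub>}" for N
  proof -
    have "x = \<one>\<^bsub>G\<^esub>" if "x \<in> N" for x
    proof (rule inj_onD[OF assms(4)])
      show "x \<in> carrier G" using that N(1) subgroup.subset by blast
      show "\<phi> x = \<phi> \<one>\<^bsub>G\<^esub>" using that N(2) by auto
    qed simp
    then show ?thesis using subgroup.one_closed[OF N(1)] by blast
  qed
  obtain c where c: "lower_central K c = {\<one>\<^bsub>K\<^esub>}"
    using assms(2)
    by (auto simp: metabelian_nilpotent_def nilpotent_group_def nilpotent_class_le_def)
  have "lower_central G c = {\<one>\<^bsub>G\<^esub>}"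
    using triv[OF lower_central_subgroup[OF assms(1)]]
      lower_central_hom_image[OF assms(1) K assms(3)] c by metis
  moreover have "derived G (derived G (carrier G)) = {\<one>\<^bsub>G\<^esub>}"
  proof (rule triv)
    have D: "derived G (carrier G) \<subseteq> carrier G" by (simp add: G.derived_in_carrier)
    show "subgroup (derived G (derived G (carrier G))) G"
      by (rule G.derived_is_subgroup[OF D])
    have sub: "\<phi> ` derived G (carrier G) \<subseteq> derived K (carrier K)"
    proof -
      have img: "\<phi> ` carrier G \<subseteq> carrier K" using assms(3) by (auto simp: hom_def)
      show ?thesis
        using commutator_subgroup_hom_image[OF assms(1) K assms(3) subset_refl subset_refl]
          commutator_subgroup_mono[OF K img img] by (simp add: commutator_subgroup_self)
    qed
    have "\<phi> ` derived G (derived G (carrier G)) =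
        commutator_subgroup K (\<phi> ` derived G (carrier G)) (\<phi> ` derived G (carrier G))"
      using commutator_subgroup_hom_image[OF assms(1) K assms(3) D D]
      by (simp add: commutator_subgroup_self)
    also have "\<dots> \<subseteq> derived K (derived K (carrier K))"
      using commutator_subgroup_mono[OF K sub sub] by (simp add: commutator_subgroup_self)
    also have "\<dots> = {\<one>\<^bsub>K\<^esub>}"
      using assms(2) by (simp add: metabelian_nilpotent_def metabelian_group_def)
    finally show "\<phi> ` derived G (derived G (carrier G)) \<subseteq> {\<one>\<^bsub>K\<^esub>}" .
  qed
  ultimately show ?thesis
    using assms(1)
    by (auto simp: metabelian_nilpotent_def metabelian_group_def nilpotent_group_def
        nilpotent_class_le_def)
qed

lemma word_representation:
  fixes G :: "('a, 'b) monoid_scheme" and K :: "('k, 'c) monoid_scheme"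
  assumes "group G" "group K" "p \<in> hom G K" "q \<in> hom G K"
  obtains L and r :: "'k \<Rightarrow> ('a + 'a) list"
  where "subgroup L K" "p ` carrier G \<subseteq> L" "q ` carrier G \<subseteq> L" "inj_on r L"
proof -
  interpret G: group G by fact
  interpret K: group K by fact
  interpret h1: group_hom G K p using assms by (simp add: group_hom_def group_hom_axioms_def)
  interpret h2: group_hom G K q using assms by (simp add: group_hom_def group_hom_axioms_def)
  define ev where "ev w = foldr (\<lambda>x y. case_sum p q x \<otimes>\<^bsub>K\<^esub> y) w \<one>\<^bsub>K\<^esub>" for w
  define W where "W = lists (Sum_Type.Plus (carrier G) (carrier G))"
  have letter: "case_sum p q x \<in> carrier K" if "x \<in> Sum_Type.Plus (carrier G) (carrier G)" for x
    using that by auto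
  have ev_Nil: "ev [] = \<one>\<^bsub>K\<^esub>" by (simp add: ev_def)
  have ev_Cons: "ev (x # w) = case_sum p q x \<otimes>\<^bsub>K\<^esub> ev w" for x w
    by (simp add: ev_def)
  have closed: "w \<in> W \<Longrightarrow> ev w \<in> carrier K" for w
  proof (induction w)
    case Nil
    then show ?case by (simp add: ev_Nil)
  next
    case (Cons x w)
    then have "x \<in> Sum_Type.Plus (carrier G) (carrier G)" "w \<in> W" by (auto simp: W_def)
    then show ?case using Cons letter by (simp add: ev_Cons)
  qed
  have app: "u \<in> W \<Longrightarrow> v \<in> W \<Longrightarrow> ev (u @ v) = ev u \<otimes>\<^bsub>K\<^esub> ev v" for u v
  proof (induction u)
    case Nil
    then show ?case using closed by (simp add: ev_Nil)
  next
    case (Cons x u)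
    then have "x \<in> Sum_Type.Plus (carrier G) (carrier G)" "u \<in> W" by (auto simp: W_def)
    then show ?case using Cons closed letter by (simp add: ev_Cons K.m_assoc)
  qed
  have inv_ev: "w \<in> W \<Longrightarrow> \<exists>v \<in> W. ev v = inv\<^bsub>K\<^esub> ev w" for w
  proof (induction w)
    case Nil
    then show ?case by (intro bexI[of _ "[]"]) (auto simp: ev_Nil)
  next
    case (Cons x w)
    then have x: "x \<in> Sum_Type.Plus (carrier G) (carrier G)" and w: "w \<in> W" by (auto simp: W_def)
    obtain v where v: "v \<in> W" "ev v = inv\<^bsub>K\<^esub> ev w" using Cons.IH[OF w] by blast
    obtain y where y: "y \<in> Sum_Type.Plus (carrier G) (carrier G)" "case_sum p q y = inv\<^bsub>K\<^esub> case_sum p q x"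
    proof -
      from x consider a where "a \<in> carrier G" "x = Inl a" | a where "a \<in> carrier G" "x = Inr a"
        by auto
      then show thesis
      proof cases
        case 1
        then show thesis using that[of "Inl (inv\<^bsub>G\<^esub> a)"] by auto
      next
        case 2
        then show thesis using that[of "Inr (inv\<^bsub>G\<^esub> a)"] by auto
      qed
    qed
    have yW: "[y] \<in> W" using y by (simp add: W_def)
    have "ev (v @ [y]) = inv\<^bsub>K\<^esub> ev (x # w)"
      using app[OF v(1) yW] v y x letter closed[OF w]
      by (simp add: ev_Cons ev_Nil K.inv_mult_group)
    moreover have "v @ [y] \<in> W" using v yW by (simp add: W_def)
    ultimately show ?case by blast
  qed
  have "subgroup (ev ` W) K"
  proof (rule K.subgroupI)
    show "ev ` W \<subseteq> carrier K" using closed by blast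
    show "ev ` W \<noteq> {}" by (auto simp: W_def)
    show "inv\<^bsub>K\<^esub> a \<in> ev ` W" if a: "a \<in> ev ` W" for a
    proof -
      obtain w where w: "w \<in> W" "a = ev w" using a by blast
      then obtain v where "v \<in> W" "ev v = inv\<^bsub>K\<^esub> ev w" using inv_ev by blast
      then show ?thesis using w by force
    qed
    show "a \<otimes>\<^bsub>K\<^esub> b \<in> ev ` W" if ab: "a \<in> ev ` W" "b \<in> ev ` W" for a b
    proof -
      obtain u v where uv: "u \<in> W" "v \<in> W" "a = ev u" "b = ev v" using ab by blast
      then have "u @ v \<in> W" by (simp add: W_def)
      then show ?thesis using app[OF uv(1,2)] uv(3,4) by (metis image_eqI)
    qed
  qed
  moreover have "p ` carrier G \<subseteq> ev ` W"
  proof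
    fix y assume "y \<in> p ` carrier G"
    then obtain a where "a \<in> carrier G" "y = p a" by blast
    then have "y = ev [Inl a]" "[Inl a] \<in> W" by (auto simp: ev_Cons ev_Nil W_def)
    then show "y \<in> ev ` W" by blast
  qed
  moreover have "q ` carrier G \<subseteq> ev ` W"
  proof
    fix y assume "y \<in> q ` carrier G"
    then obtain a where "a \<in> carrier G" "y = q a" by blast
    then have "y = ev [Inr a]" "[Inr a] \<in> W" by (auto simp: ev_Cons ev_Nil W_def)
    then show "y \<in> ev ` W" by blast
  qed
  moreover have "inj_on (inv_into W ev) (ev ` W)"
    by (rule inj_on_inv_into) simp
  ultimately show thesis by (rule that)
qed

lemma dominion_metabelian_nilpotentD:
  fixes G :: "('a, 'b) monoid_scheme" and K :: "('k, 'c) monoid_scheme"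
  assumes G: "group G" and g: "g \<in> dominion metabelian_nilpotent G H"
    and K: "metabelian_nilpotent K" and f: "p \<in> hom G K" "q \<in> hom G K"
    and eq: "\<And>h. h \<in> H \<Longrightarrow> p h = q h"
  shows "p g = q g"
proof -
  have grpK: "group K" using K by (simp add: metabelian_nilpotent_def metabelian_group_def)
  interpret K: group K by fact
  obtain L and r :: "'k \<Rightarrow> ('a + 'a) list"
    where L: "subgroup L K" "p ` carrier G \<subseteq> L" "q ` carrier G \<subseteq> L" "inj_on r L"
    by (rule word_representation[OF G grpK f])
  define M where "M = K\<lparr>carrier := L\<rparr>"
  have M: "group M" "carrier M = L" unfolding M_def
    using subgroup.subgroup_is_group[OF L(1) grpK] by simp_all
  have r: "inj_on r (carrier M)" using L(4) M(2) by simp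
  define K' where "K' = \<lparr>carrier = r ` L,
    mult = (\<lambda>x y. r (inv_into L r x \<otimes>\<^bsub>K\<^esub> inv_into L r y)), one = r \<one>\<^bsub>K\<^esub>\<rparr>"
  have iso: "r \<in> iso M K'"
    using L(4) by (auto simp: iso_def hom_def bij_betw_def K'_def M_def)
  have grp: "group K'"
    using group.iso_imp_img_group[OF M(1) iso] by (simp add: K'_def M_def)
  define s where "s = inv_into (carrier M) r"
  have "s \<in> iso K' M" unfolding s_def by (rule group.iso_set_sym[OF M(1) iso])
  then have s: "s \<in> hom K' K" "inj_on s (carrier K')"
    using subgroup.subset[OF L(1)]
    by (auto simp: iso_def bij_betw_def hom_def M_def Pi_iff)
  have MN: "metabelian_nilpotent K'"
    by (rule metabelian_nilpotent_inj_hom[OF grp K s])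
  have h: "r \<circ> f' \<in> hom G K'" if "f' \<in> hom G K" "f' ` carrier G \<subseteq> L" for f'
  proof (rule hom_compose)
    show "f' \<in> hom G M" using that by (auto simp: hom_def M_def)
    show "r \<in> hom M K'" using iso by (simp add: iso_def)
  qed
  have "g \<in> carrier G" using g by (simp add: dominion_def)
  have "(r \<circ> p) g = (r \<circ> q) g"
  proof -
    have "\<forall>f\<^sub>1 \<in> hom G K'. \<forall>f\<^sub>2 \<in> hom G K'. (\<forall>h \<in> H. f\<^sub>1 h = f\<^sub>2 h) \<longrightarrow> f\<^sub>1 g = f\<^sub>2 g"
      using g MN by (simp add: dominion_def)
    moreover have "\<forall>h \<in> H. (r \<circ> p) h = (r \<circ> q) h" using eq by simp
    ultimately show ?thesis using h[OF f(1) L(2)] h[OF f(2) L(3)] by blast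
  qed
  then show ?thesis
    using inj_onD[OF L(4), of "p g" "q g"] L(2,3) \<open>g \<in> carrier G\<close> by auto
qed

end

theory Submission
  imports Defs "HOL-Algebra.Sylow" "HOL-Algebra.Group_Action" "HOL-Algebra.Multiplicative_Group"
    "HOL-Algebra.SndIsomorphismGrp"
begin

text \<open>
  Suppose \<open>g \<notin> H\<close>.  Passing to the quotient by a normal subgroup \<open>L\<close> maximal with
  \<open>g \<notin> HL\<close>, one may assume that \<open>g \<in> HM\<close> for every nontrivial normal subgroup \<open>M\<close>.  Then
  \<open>H\<close> meets the centre trivially.  If \<open>G\<close> is abelian, \<open>H = 1\<close>, and the identity and the trivial map
  separate \<open>g\<close> from \<open>H\<close>.  Otherwise \<open>g = hz\<close> with \<open>1 \<noteq> z \<in> N = [G, G]\<close>, and \<open>z\<close> lies in every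
  nontrivial central subgroup; hence the centre is a \<open>p\<close>-group for some prime \<open>p\<close>, and since
  \<open>G\<close> is finitely generated of class two, \<open>G\<close> is a finite \<open>p\<close>-group.

  Let \<open>K\<close> consist of the pairs \<open>(\<phi>, g)\<close> with \<open>g \<in> G\<close> and \<open>\<phi> : G \<rightarrow> N\<close> such that
  \<open>\<phi>(xz)/\<phi>(x)\<close> depends only on \<open>z \<in> N\<close>, with the multiplication of the wreath product
  of \<open>N\<close> by \<open>G\<close>.  It is a finite \<open>p\<close>-group, hence nilpotent.  It is metabelian, because
  commutators have \<open>N\<close>-invariant first component and second component in \<open>N\<close>, and such pairs
  commute.  As \<open>H \<inter> N = 1\<close>, there is \<open>\<phi>\<close> with \<open>\<phi>(xh) = \<phi>(x)\<close> for \<open>h \<in> H\<close> and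
  \<open>\<phi>(xz) = \<phi>(x)z\<close> for \<open>z \<in> N\<close>; conjugation by \<open>(\<phi>, 1)\<close> fixes \<open>H\<close> but moves every
  nontrivial element of \<open>N\<close>.
\<close>

section \<open>Centres and central subgroups\<close>

definition center :: "('a, 'b) monoid_scheme \<Rightarrow> 'a set" where
  "center G = {z \<in> carrier G. \<forall>x \<in> carrier G. z \<otimes>\<^bsub>G\<^esub> x = x \<otimes>\<^bsub>G\<^esub> z}"

definition p_group :: "nat \<Rightarrow> ('a, 'b) monoid_scheme \<Rightarrow> bool" where
  "p_group p G \<longleftrightarrow> (\<forall>x \<in> carrier G. \<exists>k. x [^]\<^bsub>G\<^esub> (p ^ k) = \<one>\<^bsub>G\<^esub>)"

lemma (in group_hom) normal_vimage:
  assumes "M \<lhd> H"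
  shows "{a \<in> carrier G. h a \<in> M} \<lhd> G"
proof -
  interpret M: normal M H by fact
  show ?thesis
    unfolding G.normal_inv_iff
  proof (intro conjI ballI G.subgroupI)
    show "{a \<in> carrier G. h a \<in> M} \<noteq> {}" using hom_one M.one_closed G.one_closed by fastforce
  qed (auto simp: M.inv_op_closed2)
qed

context group
begin

lemma centerD: "z \<in> center G \<Longrightarrow> z \<in> carrier G"
  and center_comm: "z \<in> center G \<Longrightarrow> x \<in> carrier G \<Longrightarrow> z \<otimes> x = x \<otimes> z"
  by (auto simp: center_def)

lemma subgroup_center: "subgroup (center G) G"
proof (rule subgroupI)
  show "inv z \<in> center G" if "z \<in> center G" for z
    unfolding center_def
  proof (intro CollectI conjI ballI)
    show "inv z \<in> carrier G" using that centerD by simp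
    fix x assume "x \<in> carrier G"
    then show "inv z \<otimes> x = x \<otimes> inv z"
      using that center_comm[OF that, of x] centerD[OF that]
      by (metis inv_closed inv_solve_left inv_solve_right m_assoc m_closed)
  qed
  show "y \<otimes> z \<in> center G" if "y \<in> center G" "z \<in> center G" for y z
    unfolding center_def
  proof (intro CollectI conjI ballI)
    show "y \<otimes> z \<in> carrier G" using that centerD by simp
    fix x assume x: "x \<in> carrier G"
    have "y \<otimes> z \<otimes> x = y \<otimes> (x \<otimes> z)"
      using that x by (simp add: centerD m_assoc center_comm[OF that(2)])
    also have "\<dots> = y \<otimes> x \<otimes> z" using that x by (simp add: centerD m_assoc)
    also have "\<dots> = x \<otimes> (y \<otimes> z)"
      using that x by (simp add: centerD m_assoc center_comm[OF that(1)])
    finally show "y \<otimes> z \<otimes> x = x \<otimes> (y \<otimes> z)" .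
  qed
qed (auto simp: center_def)

lemma central_subgroup_normal:
  assumes "subgroup M G" "M \<subseteq> center G"
  shows "M \<lhd> G"
  unfolding normal_inv_iff
proof (intro conjI ballI)
  fix x z assume "x \<in> carrier G" "z \<in> M"
  moreover from this have "x \<otimes> z \<otimes> inv x = z"
    using assms(2) center_comm[of z x] centerD[of z] by (metis inv_solve_right' m_closed subsetD)
  ultimately show "x \<otimes> z \<otimes> inv x \<in> M" by simp
qed (rule assms(1))

section \<open>Finite p-groups and their nilpotency\<close>

text \<open>A second prime \<open>q\<close> dividing the order would give, by Sylow's theorem, a
  subgroup of order \<open>q\<close>. A nontrivial element in it would have order dividing both
  \<open>q\<close> and a power of \<open>p\<close>.\<close>

lemma p_group_order:
  assumes fin: "finite (carrier G)" and p: "prime p" and pG: "p_group p G"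
  obtains n where "order G = p ^ n"
proof -
  have pos: "order G > 0" using fin by (simp add: order_gt_0_iff_finite)
  then obtain m where m: "order G = p ^ multiplicity p (order G) * m" "\<not> p dvd m"
    using multiplicity_decompose'[of "order G" p] p
    by (metis not_prime_unit gr_implies_not0 )
  have "m = 1"
  proof (rule ccontr)
    assume "m \<noteq> 1"
    then obtain q where q: "prime q" "q dvd m" using prime_factor_nat by blast
    then have "q dvd order G" using m(1) by (metis dvd_mult)
    then obtain r where "order G = q ^ 1 * r" by (auto elim: dvdE)
    then obtain Q where Q: "subgroup Q G" "card Q = q"
      using sylow_thm[OF q(1) is_group _ fin] by fastforce
    interpret Q: group "G\<lparr>carrier := Q\<rparr>" by (rule subgroup_imp_group[OF Q(1)])
    have finQ: "finite Q" using Q(1) fin finite_subset subgroup.subset by blast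
    have "\<not> Q \<subseteq> {\<one>}"
      using Q(2) q(1) card_mono[of "{\<one>}" Q] prime_gt_1_nat[of q] by auto
    then obtain x where x: "x \<in> Q" "x \<noteq> \<one>" by blast
    have xG: "x \<in> carrier G" using x Q(1) subgroup.mem_carrier by metis
    have "x [^] q = \<one>"
      using Q.pow_order_eq_1[of x] x finQ Q(2) nat_pow_consistent[of x q Q] by (simp add: order_def)
    then have "ord x dvd q" using xG pow_eq_id by blast
    moreover obtain k where "x [^] (p ^ k) = \<one>" using pG xG unfolding p_group_def by blast
    then have "ord x dvd p ^ k" using xG pow_eq_id by blast
    moreover have "coprime q (p ^ k)"
      using p q m(2) by (metis coprime_power_right_iff primes_coprime)
    ultimately have "ord x = 1" using coprime_common_divisor_nat by blast
    then show False using ord_eq_1[OF xG] x(2) by simp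
  qed
  then show thesis using that m(1) by simp
qed

text \<open>This is the class equation. By orbit-stabilizer every conjugacy class has
  \<open>p\<close>-power size, and a class of size one consists of a central element. With a trivial
  centre the order would be congruent to 1 modulo \<open>p\<close>.\<close>

lemma center_nontrivial_if_prime_power_order:
  assumes fin: "finite (carrier G)" and p: "prime p" and n: "order G = p ^ n"
    and nontriv: "carrier G \<noteq> {\<one>}"
  shows "center G \<noteq> {\<one>}"
proof
  assume Z: "center G = {\<one>}"
  define \<phi> where "\<phi> = (\<lambda>g. \<lambda>h \<in> carrier G. g \<otimes> h \<otimes> inv g)"
  let ?O = "orbits G (carrier G) \<phi>"
  interpret act: group_action G "carrier G" \<phi> unfolding \<phi>_def by (rule action_by_conjugation)
  have part: "\<Union>?O = carrier G" "pairwise disjnt ?O"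
    using act.disjoint_union act.orbits_coverture by (auto simp: pairwise_def disjnt_def)
  have sub: "C \<subseteq> carrier G" if "C \<in> ?O" for C using that part(1) by blast
  have finO: "finite ?O" by (rule finite_UnionD) (simp only: part(1) fin)
  have one: "{\<one>} \<in> ?O"
  proof -
    have "{\<one>} = orbit G \<phi> \<one>" by (auto simp: orbit_def \<phi>_def intro!: exI[of _ \<one>])
    with one_closed have "\<exists>x. {\<one>} = orbit G \<phi> x \<and> x \<in> carrier G" by metis
    then show ?thesis unfolding orbits_def by (rule CollectI)
  qed
  have big: "p dvd card C" if C: "C \<in> ?O - {{\<one>}}" for C
  proof -
    obtain x where x: "x \<in> carrier G" "C = orbit G \<phi> x" using C by (auto simp: orbits_def)
    have xC: "x \<in> C" using act.orbit_refl[OF x(1)] x(2) by simp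
    have "p ^ n = card C * card (stabilizer G \<phi> x)"
      using act.orbit_stabilizer_theorem[OF x(1)] unfolding n x(2) by (rule sym)
    then have "card C dvd p ^ n" by (rule dvdI)
    then obtain k where k: "card C = p ^ k" using p divides_primepow_nat by blast
    have "k \<noteq> 0"
    proof
      assume "k = 0"
      then have C1: "C = {x}" using k xC by (auto simp: card_1_singleton_iff)
      have "x \<in> center G" unfolding center_def
      proof (intro CollectI conjI ballI x(1))
        fix g assume g: "g \<in> carrier G"
        then have "g \<otimes> x \<otimes> inv g \<in> C" using x by (auto simp: orbit_def \<phi>_def)
        then have "g \<otimes> x \<otimes> inv g = x" using C1 by simp
        then show "x \<otimes> g = g \<otimes> x" using g x(1) by (metis inv_solve_right' m_closed)
      qed
      then have "C = {\<one>}" using Z C1 by simp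
      then show False using C by blast
    qed
    then show ?thesis using k by simp
  qed
  have "card (\<Union>?O) = (\<Sum>C \<in> ?O. card C)"
    by (rule card_Union_disjoint[OF part(2)]) (rule finite_subset[OF sub fin])
  then have "order G = (\<Sum>C \<in> ?O. card C)" unfolding order_def part(1) .
  also have "\<dots> = 1 + (\<Sum>C \<in> ?O - {{\<one>}}. card C)"
    using sum.remove[OF finO one, of card] by simp
  finally have "order G = 1 + (\<Sum>C \<in> ?O - {{\<one>}}. card C)" .
  moreover have "p dvd (\<Sum>C \<in> ?O - {{\<one>}}. card C)" by (rule dvd_sum) (rule big)
  moreover have "p dvd order G"
  proof (cases n)
    case 0
    then have "card (carrier G) = 1" using n by (simp add: order_def)
    then show ?thesis using nontriv one_closed by (metis card_1_singletonE singletonD)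
  qed (use n in simp)
  ultimately show False using p
    by (metis dvd_add_left_iff nat_dvd_1_iff_1 not_prime_1)
qed

lemma commutator_subgroup_le:
  assumes "subgroup M G"
    and "\<And>a b. a \<in> A \<Longrightarrow> b \<in> B \<Longrightarrow> a \<otimes> b \<otimes> inv a \<otimes> inv b \<in> M"
  shows "commutator_subgroup G A B \<subseteq> M"
  unfolding commutator_subgroup_def
  by (rule generate_subgroup_incl) (use assms in auto)

text \<open>
  Induction on the index: the preimage \<open>M'\<close> of the centre of \<open>G Mod M\<close> is strictly larger than \<open>M\<close>,
  and \<open>[M', G] \<subseteq> M\<close>.
\<close>

lemma finite_p_group_lower_central_le_normal:
  assumes fin: "finite (carrier G)" and p: "prime p" and pG: "p_group p G" and M: "M \<lhd> G"
  shows "\<exists>c. lower_central G c \<subseteq> M"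
  using M
proof (induction "card (carrier G) - card M" arbitrary: M rule: less_induct)
  case less
  interpret M: normal M G by (rule less.prems)
  show ?case
  proof (cases "M = carrier G")
    case True
    then show ?thesis by (intro exI[of _ 0]) simp
  next
    case False
    let ?Q = "G Mod M"
    interpret Q: group ?Q by (rule M.factorgroup_is_group)
    interpret \<pi>: group_hom G ?Q "\<lambda>a. M #> a"
      using M.r_coset_hom_Mod by (simp add: group_hom_def group_hom_axioms_def is_group Q.is_group)
    have carQ: "carrier ?Q = (\<lambda>a. M #> a) ` carrier G"
      by (auto simp: FactGroup_def RCOSETS_def)
    have finQ: "finite (carrier ?Q)" using carQ fin by simp
    have "p_group p ?Q" unfolding p_group_def
    proof
      fix X assume "X \<in> carrier ?Q"
      then obtain a where a: "a \<in> carrier G" "X = M #> a" using carQ by blast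
      then obtain k where "a [^] (p ^ k) = \<one>" using pG unfolding p_group_def by blast
      then have "X [^]\<^bsub>?Q\<^esub> (p ^ k) = M #> \<one>" using \<pi>.hom_nat_pow[OF a(1)] a(2) by metis
      then show "\<exists>k. X [^]\<^bsub>?Q\<^esub> (p ^ k) = \<one>\<^bsub>?Q\<^esub>" using \<pi>.hom_one by metis
    qed
    then obtain n where "order ?Q = p ^ n" using Q.p_group_order[OF finQ p] by blast
    moreover have "carrier ?Q \<noteq> {\<one>\<^bsub>?Q\<^esub>}"
    proof
      assume 1: "carrier ?Q = {\<one>\<^bsub>?Q\<^esub>}"
      have "a \<in> M" if a: "a \<in> carrier G" for a
      proof -
        have "M #> a = M" using 1 a carQ by auto
        then show ?thesis using a rcos_self[OF a M.subgroup_axioms] by simp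
      qed
      then show False using False M.subset by blast
    qed
    ultimately have "center ?Q \<noteq> {\<one>\<^bsub>?Q\<^esub>}"
      using Q.center_nontrivial_if_prime_power_order[OF finQ p] by blast
    then obtain X where X: "X \<in> center ?Q" "X \<noteq> \<one>\<^bsub>?Q\<^esub>"
      using subgroup.one_closed[OF Q.subgroup_center] by blast
    define M' where "M' = {a \<in> carrier G. M #> a \<in> center ?Q}"
    have nZ: "center ?Q \<lhd> ?Q" by (rule Q.central_subgroup_normal[OF Q.subgroup_center subset_refl])
    have M': "M' \<lhd> G" unfolding M'_def by (rule \<pi>.normal_vimage[OF nZ])
    have "M \<subseteq> M'"
    proof
      fix a assume a: "a \<in> M"
      then have "M #> a = \<one>\<^bsub>?Q\<^esub>" by (simp add: M.rcos_const)
      then show "a \<in> M'" using a subgroup.one_closed[OF Q.subgroup_center]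
        by (simp add: M'_def)
    qed
    moreover have "M \<noteq> M'"
    proof
      obtain a where a: "a \<in> carrier G" "X = M #> a" using X(1) carQ Q.centerD by blast
      assume "M = M'"
      then have "a \<in> M" using a X(1) by (auto simp: M'_def)
      then show False using X(2) a(2) by (simp add: M.rcos_const)
    qed
    ultimately have "M \<subset> M'" by blast
    moreover have "M' \<subseteq> carrier G" by (auto simp: M'_def)
    ultimately have "card (carrier G) - card M' < card (carrier G) - card M"
      using fin by (meson card_mono diff_less_mono2 finite_subset order_less_le_trans psubset_card_mono)
    then obtain c where c: "lower_central G c \<subseteq> M'" using less.hyps M' by blast
    have "lower_central G (Suc c) \<subseteq> M"
      unfolding lower_central.simps
    proof (rule commutator_subgroup_le)
      show "subgroup M G" by (rule M.subgroup_axioms)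
      fix a b assume "a \<in> lower_central G c" and b: "b \<in> carrier G"
      then have a: "a \<in> carrier G" "M #> a \<in> center ?Q" using c by (auto simp: M'_def)
      \<comment> \<open>Since the coset of \<open>a\<close> is central in the quotient,
        \<open>a \<otimes> b\<close> and \<open>b \<otimes> a\<close> lie in the same coset, so
        their quotient, the commutator, lies in \<open>M\<close>.\<close>
      have "M #> (a \<otimes> b) = M #> (b \<otimes> a)"
        using Q.center_comm[OF a(2), of "M #> b"] a(1) b \<pi>.hom_mult \<pi>.hom_closed by metis
      then have "a \<otimes> b \<in> M #> (b \<otimes> a)" using rcos_self[OF _ M.subgroup_axioms] a(1) b by (metis m_closed)
      then have "a \<otimes> b \<otimes> inv (b \<otimes> a) \<in> M"
        using a(1) b M.rcos_module_imp[of "b \<otimes> a" "a \<otimes> b"] is_group by simp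
      then show "a \<otimes> b \<otimes> inv a \<otimes> inv b \<in> M"
        using a(1) b by (simp add: inv_mult_group m_assoc)
    qed
    then show ?thesis by blast
  qed
qed

lemma finite_p_group_nilpotent:
  assumes "finite (carrier G)" "prime p" "p_group p G"
  shows "nilpotent_group G"
proof -
  obtain c where "lower_central G c \<subseteq> {\<one>}"
    using finite_p_group_lower_central_le_normal[OF assms one_is_normal] by blast
  moreover have "\<one> \<in> lower_central G c"
    using subgroup.one_closed[OF lower_central_subgroup[OF is_group]] .
  ultimately show ?thesis
    using is_group unfolding nilpotent_group_def nilpotent_class_le_def by blast
qed

end

section \<open>The metabelian test group inside a wreath product\<close>

text \<open>
  The condition says that \<open>\<phi>(xz) / \<phi>(x)\<close> does not depend on \<open>x\<close>; it is written without inverses,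
  \<open>N\<close> being abelian.
\<close>

definition shift_maps :: "('a, 'b) monoid_scheme \<Rightarrow> 'a set \<Rightarrow> ('a \<Rightarrow> 'a) set" where
  "shift_maps G N = {\<phi> \<in> carrier G \<rightarrow>\<^sub>E N. \<forall>x \<in> carrier G. \<forall>y \<in> carrier G. \<forall>z \<in> N.
     \<phi> (x \<otimes>\<^bsub>G\<^esub> z) \<otimes>\<^bsub>G\<^esub> \<phi> y = \<phi> (y \<otimes>\<^bsub>G\<^esub> z) \<otimes>\<^bsub>G\<^esub> \<phi> x}"

text \<open>The element \<open>g\<close> acts on maps by right translation of the argument. Products
  are restricted to \<open>carrier G\<close> to stay extensional, so equality of first components is
  equality of values on \<open>G\<close>.\<close>

definition shift_group :: "('a, 'b) monoid_scheme \<Rightarrow> 'a set \<Rightarrow> (('a \<Rightarrow> 'a) \<times> 'a) monoid" where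
  "shift_group G N = \<lparr>carrier = shift_maps G N \<times> carrier G,
     monoid.mult = (\<lambda>(\<phi>, g) (\<psi>, h). (\<lambda>x \<in> carrier G. \<phi> x \<otimes>\<^bsub>G\<^esub> \<psi> (x \<otimes>\<^bsub>G\<^esub> g), g \<otimes>\<^bsub>G\<^esub> h)),
     one = (\<lambda>x \<in> carrier G. \<one>\<^bsub>G\<^esub>, \<one>\<^bsub>G\<^esub>)\<rparr>"

lemma (in group) commutator_mem_derived:
  assumes "x \<in> carrier G" "y \<in> carrier G"
  shows "x \<otimes> y \<otimes> inv x \<otimes> inv y \<in> derived G (carrier G)"
  unfolding derived_def by (rule generate.incl) (use assms in blast)

locale central_subgroup = group G for G (structure) +
  fixes N
  assumes subN: "subgroup N G" and N_central: "N \<subseteq> center G"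
begin

lemma N_carrier [simp]: "z \<in> N \<Longrightarrow> z \<in> carrier G"
  using subgroup.mem_carrier[OF subN] .

lemma N_closed [simp]: "y \<in> N \<Longrightarrow> z \<in> N \<Longrightarrow> y \<otimes> z \<in> N" "z \<in> N \<Longrightarrow> inv z \<in> N" "\<one> \<in> N"
  using subN by (simp_all add: subgroup.m_closed subgroup.m_inv_closed subgroup.one_closed)

lemma N_comm: "z \<in> N \<Longrightarrow> x \<in> carrier G \<Longrightarrow> x \<otimes> z = z \<otimes> x"
  using N_central center_comm by fastforce

lemma N_lcomm: "z \<in> N \<Longrightarrow> x \<in> carrier G \<Longrightarrow> y \<in> carrier G \<Longrightarrow> x \<otimes> (z \<otimes> y) = z \<otimes> (x \<otimes> y)"
  using N_comm[of z x] by (simp flip: m_assoc)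

abbreviation K where "K \<equiv> shift_group G N"

lemma shift_maps_closed: "\<phi> \<in> shift_maps G N \<Longrightarrow> x \<in> carrier G \<Longrightarrow> \<phi> x \<in> N"
  by (auto simp: shift_maps_def)

lemma shift_maps_carrier: "\<phi> \<in> shift_maps G N \<Longrightarrow> x \<in> carrier G \<Longrightarrow> \<phi> x \<in> carrier G"
  by (simp add: shift_maps_closed)

lemma shift_maps_shift:
  "\<phi> \<in> shift_maps G N \<Longrightarrow> x \<in> carrier G \<Longrightarrow> y \<in> carrier G \<Longrightarrow> z \<in> N \<Longrightarrow>
     \<phi> (x \<otimes> z) \<otimes> \<phi> y = \<phi> (y \<otimes> z) \<otimes> \<phi> x"
  by (simp add: shift_maps_def)

lemma shift_maps_one: "(\<lambda>x \<in> carrier G. \<one>) \<in> shift_maps G N"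
  by (auto simp: shift_maps_def)

text \<open>Since \<open>z\<close> is central it can be moved past \<open>g\<close>. Since values
  lie in the abelian \<open>N\<close>, the required identity is the product of the identity for
  \<phi> at \<open>x\<close>, \<open>y\<close> and the one for \<psi> at
  \<open>x \<otimes> g\<close>, \<open>y \<otimes> g\<close>.\<close>

lemma shift_maps_mult:
  assumes \<phi>: "\<phi> \<in> shift_maps G N" and \<psi>: "\<psi> \<in> shift_maps G N" and g: "g \<in> carrier G"
  shows "(\<lambda>x \<in> carrier G. \<phi> x \<otimes> \<psi> (x \<otimes> g)) \<in> shift_maps G N"
proof -
  have "\<phi> (x \<otimes> z) \<otimes> \<psi> (x \<otimes> z \<otimes> g) \<otimes> (\<phi> y \<otimes> \<psi> (y \<otimes> g)) =
      \<phi> (y \<otimes> z) \<otimes> \<psi> (y \<otimes> z \<otimes> g) \<otimes> (\<phi> x \<otimes> \<psi> (x \<otimes> g))"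
    if x: "x \<in> carrier G" and y: "y \<in> carrier G" and z: "z \<in> N" for x y z
  proof -
    have swap: "a \<otimes> b \<otimes> (c \<otimes> d) = (a \<otimes> c) \<otimes> (b \<otimes> d)" if "a \<in> N" "b \<in> N" "c \<in> N" "d \<in> N" for a b c d
      using that N_lcomm[of c b d] by (simp add: m_assoc)
    have e: "u \<otimes> z \<otimes> g = u \<otimes> g \<otimes> z" if "u \<in> carrier G" for u
      using that z g N_comm[of z g] by (simp add: m_assoc)
    note c = shift_maps_closed[OF \<phi>] shift_maps_closed[OF \<psi>]
    show ?thesis
      unfolding e[OF x] e[OF y]
      using x y z g shift_maps_shift[OF \<phi> x y z] shift_maps_shift[OF \<psi>, of "x \<otimes> g" "y \<otimes> g" z]
      by (simp add: swap c)
  qed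
  then show ?thesis
    using g by (auto simp: shift_maps_def[of G N] shift_maps_closed[OF \<phi>] shift_maps_closed[OF \<psi>])
qed

text \<open>This map is the first component of the inverse of \<open>(\<phi>, inv g)\<close>. Its
  shift identity is the one for \<phi> at \<open>x \<otimes> g\<close> and
  \<open>y \<otimes> g\<close>, inverted.\<close>

lemma shift_maps_inv:
  assumes \<phi>: "\<phi> \<in> shift_maps G N" and g: "g \<in> carrier G"
  shows "(\<lambda>x \<in> carrier G. inv (\<phi> (x \<otimes> g))) \<in> shift_maps G N"
proof -
  have "inv (\<phi> (x \<otimes> z \<otimes> g)) \<otimes> inv (\<phi> (y \<otimes> g)) = inv (\<phi> (y \<otimes> z \<otimes> g)) \<otimes> inv (\<phi> (x \<otimes> g))"
    if x: "x \<in> carrier G" and y: "y \<in> carrier G" and z: "z \<in> N" for x y z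
  proof -
    have e: "u \<otimes> z \<otimes> g = u \<otimes> g \<otimes> z" if "u \<in> carrier G" for u
      using that z g N_comm[of z g] by (simp add: m_assoc)
    have i: "inv a \<otimes> inv b = inv (a \<otimes> b)" if "a \<in> N" "b \<in> N" for a b
      using that N_comm[of a b] by (simp add: inv_mult_group[symmetric])
    show ?thesis
      unfolding e[OF x] e[OF y]
      using x y z g shift_maps_shift[OF \<phi>, of "x \<otimes> g" "y \<otimes> g" z]
      by (simp add: i shift_maps_closed[OF \<phi>])
  qed
  then show ?thesis
    using g by (auto simp: shift_maps_def[of G N] shift_maps_closed[OF \<phi>])
qed

lemma shift_group_simps:
  "carrier K = shift_maps G N \<times> carrier G"
  "(\<phi>, g) \<otimes>\<^bsub>K\<^esub> (\<psi>, h) = (\<lambda>x \<in> carrier G. \<phi> x \<otimes> \<psi> (x \<otimes> g), g \<otimes> h)"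
  "\<one>\<^bsub>K\<^esub> = (\<lambda>x \<in> carrier G. \<one>, \<one>)"
  by (simp_all add: shift_group_def)

lemma group_shift_group: "group K"
proof (rule groupI)
  show "a \<otimes>\<^bsub>K\<^esub> b \<in> carrier K" if "a \<in> carrier K" "b \<in> carrier K" for a b
    using that shift_maps_mult by (cases a; cases b) (auto simp: shift_group_simps)
  show "\<one>\<^bsub>K\<^esub> \<in> carrier K" by (simp add: shift_group_simps shift_maps_one)
  show "a \<otimes>\<^bsub>K\<^esub> b \<otimes>\<^bsub>K\<^esub> c = a \<otimes>\<^bsub>K\<^esub> (b \<otimes>\<^bsub>K\<^esub> c)"
    if "a \<in> carrier K" "b \<in> carrier K" "c \<in> carrier K" for a b c
    using that by (cases a; cases b; cases c)
      (auto simp: shift_group_simps m_assoc shift_maps_carrier intro!: restrict_ext)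
  show "\<one>\<^bsub>K\<^esub> \<otimes>\<^bsub>K\<^esub> a = a" if a: "a \<in> carrier K" for a
  proof -
    obtain \<phi> g where [simp]: "a = (\<phi>, g)" by (cases a)
    \<comment> \<open>Multiplication by the identity restricts the map to \<open>carrier G\<close>;
      extensionality makes the restriction equal to \<phi> itself.\<close>
    have "\<phi> \<in> extensional (carrier G)" "\<phi> \<in> shift_maps G N"
      using a by (auto simp: shift_group_simps shift_maps_def PiE_def)
    then show ?thesis
      using a by (auto simp: shift_group_simps shift_maps_carrier extensional_def)
  qed
  show "\<exists>b \<in> carrier K. b \<otimes>\<^bsub>K\<^esub> a = \<one>\<^bsub>K\<^esub>" if a: "a \<in> carrier K" for a
  proof -
    obtain \<phi> g where [simp]: "a = (\<phi>, g)" by (cases a)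
    \<comment> \<open>In the product of \<open>?b\<close> with \<open>a\<close>, the map of
      \<open>a\<close> is evaluated at \<open>x \<otimes> inv g\<close>, so the inverse values are
      taken there.\<close>
    let ?b = "(\<lambda>x \<in> carrier G. inv (\<phi> (x \<otimes> inv g)), inv g)"
    have "?b \<otimes>\<^bsub>K\<^esub> a = \<one>\<^bsub>K\<^esub>"
      using a by (auto simp: shift_group_simps shift_maps_carrier intro!: restrict_ext)
    moreover have "?b \<in> carrier K"
      using a shift_maps_inv by (simp add: shift_group_simps)
    ultimately show ?thesis by blast
  qed
qed

interpretation K: group K by (rule group_shift_group)

lemma snd_hom: "snd \<in> hom K G"
  by (auto simp: hom_def shift_group_simps)

lemma embed_hom: "(\<lambda>g. (\<lambda>x \<in> carrier G. \<one>, g)) \<in> hom G K"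
  by (auto simp: hom_def shift_group_simps shift_maps_one intro!: restrict_ext)

text \<open>The kernels of these homomorphisms cut out the \<open>N\<close>-invariant maps.\<close>

lemma defect_hom:
  assumes z: "z \<in> N"
  shows "(\<lambda>(\<phi>, g). \<phi> z \<otimes> inv (\<phi> \<one>)) \<in> hom K (G\<lparr>carrier := N\<rparr>)"
proof (rule homI)
  show "(case a of (\<phi>, g) \<Rightarrow> \<phi> z \<otimes> inv (\<phi> \<one>)) \<in> carrier (G\<lparr>carrier := N\<rparr>)"
    if "a \<in> carrier K" for a
    using that z by (auto simp: shift_group_simps shift_maps_closed)
  fix a b assume ab: "a \<in> carrier K" "b \<in> carrier K"
  obtain \<phi> g \<psi> h where [simp]: "a = (\<phi>, g)" "b = (\<psi>, h)" by (cases a; cases b)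
  have \<phi>: "\<phi> \<in> shift_maps G N" and \<psi>: "\<psi> \<in> shift_maps G N" and g: "g \<in> carrier G"
    using ab by (auto simp: shift_group_simps)
  have c: "\<phi> z \<in> N" "\<phi> \<one> \<in> N" "\<psi> z \<in> N" "\<psi> \<one> \<in> N" "\<psi> g \<in> N" "\<psi> (g \<otimes> z) \<in> N"
    using \<phi> \<psi> z g by (simp_all add: shift_maps_closed)
  \<comment> \<open>Base points \<open>g\<close> and \<one>: the ratio of \<psi> at
    \<open>g \<otimes> z\<close> and \<open>g\<close> equals its ratio at \<open>z\<close> and
    \<one>. This removes the twist by \<open>g\<close> from the product formula.\<close>
  have "\<psi> (g \<otimes> z) \<otimes> \<psi> \<one> = \<psi> z \<otimes> \<psi> g" using shift_maps_shift[OF \<psi> g one_closed z] z by simp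
  then have e: "\<psi> (g \<otimes> z) = \<psi> z \<otimes> \<psi> g \<otimes> inv (\<psi> \<one>)"
    using c by (metis N_carrier inv_solve_right m_closed)
  have "\<phi> z \<otimes> \<psi> (z \<otimes> g) \<otimes> inv (\<phi> \<one> \<otimes> \<psi> g) = \<phi> z \<otimes> inv (\<phi> \<one>) \<otimes> (\<psi> z \<otimes> inv (\<psi> \<one>))"
    unfolding N_comm[OF z g, symmetric] e using c
    by (simp add: inv_mult_group m_assoc N_comm[of "inv (\<phi> \<one>)"] N_lcomm[of "inv (\<phi> \<one>)"])
      (simp add: N_lcomm[of "inv (\<psi> \<one>)" "\<psi> g"])
  then show "(case a \<otimes>\<^bsub>K\<^esub> b of (\<phi>, g) \<Rightarrow> \<phi> z \<otimes> inv (\<phi> \<one>)) =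
      (case a of (\<phi>, g) \<Rightarrow> \<phi> z \<otimes> inv (\<phi> \<one>)) \<otimes>\<^bsub>G\<lparr>carrier := N\<rparr>\<^esub>
      (case b of (\<phi>, g) \<Rightarrow> \<phi> z \<otimes> inv (\<phi> \<one>))"
    using z g by (simp add: shift_group_simps)
qed


lemma metabelian_shift_group:
  assumes comm: "derived G (carrier G) \<subseteq> N"
  shows "metabelian_group K"
proof -
  define c where "c z = (\<lambda>(\<phi> :: 'a \<Rightarrow> 'a, g :: 'a). \<phi> z \<otimes> inv (\<phi> \<one>))" for z
  have grpN: "group (G\<lparr>carrier := N\<rparr>)" by (rule subgroup_imp_group[OF subN])
  have c: "group_hom K (G\<lparr>carrier := N\<rparr>) (c z)" if "z \<in> N" for z
    using defect_hom[OF that] group_shift_group grpN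
    by (simp add: group_hom_def group_hom_axioms_def c_def)
  interpret s: group_hom K G snd
    using snd_hom by (simp add: group_hom_def group_hom_axioms_def K.is_group is_group)
  \<comment> \<open>\<open>D\<close> is cut out by the preimage of \<open>N\<close> under
    \<open>snd\<close> and the kernels of all \<open>c z\<close>. It contains all commutators
    because the targets of the \<open>c z\<close> are abelian and \<open>G\<close> has its
    commutators in \<open>N\<close>.\<close>
  define D where "D = {a \<in> carrier K. snd a \<in> N \<and> (\<forall>z \<in> N. c z a = \<one>)}"
  have invN: "inv\<^bsub>G\<lparr>carrier := N\<rparr>\<^esub> y = inv y" if "y \<in> N" for y
    using that m_inv_consistent[OF subN] by simp
  have cN: "c z a \<in> N" if "z \<in> N" "a \<in> carrier K" for z a
    using group_hom.hom_closed[OF c[OF that(1)] that(2)] by simp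
  have cm: "c z (a \<otimes>\<^bsub>K\<^esub> b) = c z a \<otimes> c z b"
    if "z \<in> N" "a \<in> carrier K" "b \<in> carrier K" for z a b
    using group_hom.hom_mult[OF c[OF that(1)] that(2,3)] by simp
  have ci: "c z (inv\<^bsub>K\<^esub> a) = inv (c z a)" if "z \<in> N" "a \<in> carrier K" for z a
    using group_hom.hom_inv[OF c[OF that(1)] that(2)] invN cN that by simp
  have subD: "subgroup D K"
  proof (rule K.subgroupI)
    have "c z \<one>\<^bsub>K\<^esub> = \<one>" if "z \<in> N" for z
      using group_hom.hom_one[OF c[OF that]] by simp
    then have "\<one>\<^bsub>K\<^esub> \<in> D" by (simp add: D_def)
    then show "D \<noteq> {}" by blast
  qed (auto simp: D_def cm ci)
  have "derived K (carrier K) \<subseteq> D"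
    unfolding commutator_subgroup_self[symmetric]
  proof (rule K.commutator_subgroup_le[OF subD])
    fix a b assume ab: "a \<in> carrier K" "b \<in> carrier K"
    have "snd a \<otimes> snd b \<otimes> inv (snd a) \<otimes> inv (snd b) \<in> N"
      using comm commutator_mem_derived[of "snd a" "snd b"] s.hom_closed[OF ab(1)] s.hom_closed[OF ab(2)]
      by blast
    moreover have "c z a \<otimes> c z b \<otimes> inv (c z a) \<otimes> inv (c z b) = \<one>" if z: "z \<in> N" for z
      using cN[OF z ab(1)] cN[OF z ab(2)] N_comm[of "c z b" "c z a"] by (simp add: m_assoc)
    ultimately show "a \<otimes>\<^bsub>K\<^esub> b \<otimes>\<^bsub>K\<^esub> inv\<^bsub>K\<^esub> a \<otimes>\<^bsub>K\<^esub> inv\<^bsub>K\<^esub> b \<in> D"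
      using ab by (simp add: D_def cm ci)
  qed
  moreover have "a \<otimes>\<^bsub>K\<^esub> b = b \<otimes>\<^bsub>K\<^esub> a" if ab: "a \<in> D" "b \<in> D" for a b
  proof -
    have inv: "\<phi> (x \<otimes> z) = \<phi> x"
      if "(\<phi>, g) \<in> D" "x \<in> carrier G" "z \<in> N" for \<phi> g x z
    proof -
      have \<phi>: "\<phi> \<in> shift_maps G N" and "\<phi> z \<otimes> inv (\<phi> \<one>) = \<one>"
        using that by (auto simp: D_def c_def shift_group_simps)
      then have "\<phi> z = \<phi> \<one>"
        using that(3) shift_maps_carrier[OF \<phi>] by (metis N_carrier inv_equality inv_inv inv_closed one_closed)
      \<comment> \<open>The shift condition with base points \<open>x\<close> and \<one> spreads
        invariance under \<open>z\<close> from \<one> to every \<open>x\<close>.\<close>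
      then have "\<phi> (x \<otimes> z) \<otimes> \<phi> \<one> = \<phi> x \<otimes> \<phi> \<one>"
        using shift_maps_shift[OF \<phi> that(2) one_closed that(3)] that(2,3)
          N_comm[of "\<phi> \<one>" "\<phi> x"] shift_maps_closed[OF \<phi>] by simp
      then show ?thesis using that(2,3) shift_maps_carrier[OF \<phi>] by simp
    qed
    obtain \<phi> g \<psi> h where [simp]: "a = (\<phi>, g)" "b = (\<psi>, h)" by (cases a; cases b)
    have mem: "\<phi> \<in> shift_maps G N" "\<psi> \<in> shift_maps G N" "g \<in> N" "h \<in> N"
      using ab by (auto simp: D_def shift_group_simps)
    \<comment> \<open>Translations by \<open>g\<close> and \<open>h\<close>, both in
      \<open>N\<close>, leave the maps unchanged, so both sides are products of
      \<open>\<phi> x\<close> and \<open>\<psi> x\<close> in the abelian \<open>N\<close>.\<close>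
    have "\<phi> x \<otimes> \<psi> (x \<otimes> g) = \<psi> x \<otimes> \<phi> (x \<otimes> h)" if "x \<in> carrier G" for x
      using inv[of \<phi> g x h] inv[of \<psi> h x g] ab mem that N_comm[of "\<psi> x" "\<phi> x"]
      by (simp add: shift_maps_closed)
    then show ?thesis using N_comm[of g h] mem by (auto simp: shift_group_simps)
  qed
  moreover have DK: "D \<subseteq> carrier K" by (auto simp: D_def)
  ultimately have "derived K (derived K (carrier K)) \<subseteq> {\<one>\<^bsub>K\<^esub>}"
    unfolding commutator_subgroup_self[of _ "derived K (carrier K)", symmetric]
  proof (intro K.commutator_subgroup_le K.triv_subgroup)
    fix a b assume "a \<in> derived K (carrier K)" "b \<in> derived K (carrier K)"
      and "derived K (carrier K) \<subseteq> D" "\<And>a b. a \<in> D \<Longrightarrow> b \<in> D \<Longrightarrow> a \<otimes>\<^bsub>K\<^esub> b = b \<otimes>\<^bsub>K\<^esub> a"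
    then have "a \<otimes>\<^bsub>K\<^esub> b = b \<otimes>\<^bsub>K\<^esub> a" "a \<in> carrier K" "b \<in> carrier K" using DK by blast+
    then show "a \<otimes>\<^bsub>K\<^esub> b \<otimes>\<^bsub>K\<^esub> inv\<^bsub>K\<^esub> a \<otimes>\<^bsub>K\<^esub> inv\<^bsub>K\<^esub> b \<in> {\<one>\<^bsub>K\<^esub>}"
      by (simp add: K.m_assoc)
  qed
  moreover have "\<one>\<^bsub>K\<^esub> \<in> derived K (derived K (carrier K))"
    unfolding derived_def by (rule generate.one)
  ultimately show ?thesis unfolding metabelian_group_def using K.is_group by blast
qed

text \<open>Raising to the power \<open>p ^ n\<close>, the order of \<open>G\<close>, kills the
  second component. Afterwards no translation occurs and powers are pointwise, so a second exponent
  \<open>p ^ n\<close> kills the map.\<close>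

lemma p_group_shift_group:
  assumes fin: "finite (carrier G)" and p: "prime p" and pG: "p_group p G"
  shows "p_group p K"
  unfolding p_group_def
proof
  fix a assume a: "a \<in> carrier K"
  interpret s: group_hom K G snd
    using snd_hom by (simp add: group_hom_def group_hom_axioms_def K.is_group is_group)
  obtain n where n: "order G = p ^ n" using p_group_order[OF fin p pG] .
  have "snd (a [^]\<^bsub>K\<^esub> (p ^ n)) = \<one>"
    using s.hom_nat_pow[OF a] pow_order_eq_1[of "snd a"] s.hom_closed[OF a] n by simp
  moreover have "a [^]\<^bsub>K\<^esub> (p ^ n) \<in> carrier K" using a by simp
  ultimately obtain \<psi> where \<psi>: "a [^]\<^bsub>K\<^esub> (p ^ n) = (\<psi>, \<one>)" "\<psi> \<in> shift_maps G N"
    by (cases "a [^]\<^bsub>K\<^esub> (p ^ n)") (auto simp: shift_group_simps)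
  have pow: "(\<psi>, \<one>) [^]\<^bsub>K\<^esub> (m :: nat) = (\<lambda>x \<in> carrier G. \<psi> x [^] m, \<one>)" for m
    by (induction m) (auto simp: shift_group_simps intro!: restrict_ext)
  have "a [^]\<^bsub>K\<^esub> (p ^ (n + n)) = (\<psi>, \<one>) [^]\<^bsub>K\<^esub> (p ^ n)"
    using a \<psi>(1) by (simp add: power_add flip: K.nat_pow_pow)
  also have "\<dots> = \<one>\<^bsub>K\<^esub>"
    unfolding pow using pow_order_eq_1 shift_maps_carrier[OF \<psi>(2)] n
    by (auto simp: shift_group_simps intro!: restrict_ext)
  finally show "\<exists>k. a [^]\<^bsub>K\<^esub> (p ^ k) = \<one>\<^bsub>K\<^esub>" by blast
qed

lemma finite_shift_group:
  assumes fin: "finite (carrier G)"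
  shows "finite (carrier K)"
proof -
  have "shift_maps G N \<subseteq> carrier G \<rightarrow>\<^sub>E N" by (auto simp: shift_maps_def)
  moreover have "finite N" using fin subgroup.subset[OF subN] finite_subset by blast
  ultimately have "finite (shift_maps G N)" using fin finite_PiE finite_subset by metis
  then show ?thesis using fin by (simp add: shift_group_simps)
qed

section \<open>Homomorphisms into the test group that agree on H and separate N\<close>

text \<open>Choose a representative in each coset of the subgroup \<open>H N\<close>. Every
  \<open>x\<close> is the representative times some \<open>h\<close> in \<open>H\<close> times some
  \<open>z\<close> in \<open>N\<close>, and \<open>z\<close> is unique because \<open>H\<close> and
  \<open>N\<close> meet trivially; \<phi> picks this \<open>z\<close>.\<close>

lemma shift_map_exists:
  assumes H: "subgroup H G" and HN: "H \<inter> N = {\<one>}"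
  obtains \<phi> where "\<phi> \<in> shift_maps G N"
    "\<And>x h. x \<in> carrier G \<Longrightarrow> h \<in> H \<Longrightarrow> \<phi> (x \<otimes> h) = \<phi> x"
    "\<And>x z. x \<in> carrier G \<Longrightarrow> z \<in> N \<Longrightarrow> \<phi> (x \<otimes> z) = \<phi> x \<otimes> z"
proof -
  have HG [simp]: "h \<in> carrier G" if "h \<in> H" for h using that subgroup.mem_carrier[OF H] by blast
  have Hc [simp]: "h \<otimes> h' \<in> H" "inv h \<in> H" if "h \<in> H" "h' \<in> H" for h h'
    using that subgroup.m_closed[OF H] subgroup.m_inv_closed[OF H] by blast+
  have H1 [simp]: "\<one> \<in> H" using subgroup.one_closed[OF H] .
  define C where "C x = {x \<otimes> h \<otimes> z | h z. h \<in> H \<and> z \<in> N}" for x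
  have reassoc: "x \<otimes> h \<otimes> z \<otimes> h' \<otimes> z' = x \<otimes> (h \<otimes> h') \<otimes> (z \<otimes> z')"
    if "x \<in> carrier G" "h \<in> H" "h' \<in> H" "z \<in> N" "z' \<in> N" for x h h' z z'
    using that N_lcomm[of z h' z'] by (simp add: m_assoc)
  have sub: "C (x \<otimes> h \<otimes> z) \<subseteq> C x" if "x \<in> carrier G" "h \<in> H" "z \<in> N" for x h z
    using that by (auto simp: C_def reassoc) (metis Hc(1) N_closed(1))
  have Ceq: "C (x \<otimes> h \<otimes> z) = C x" if xhz: "x \<in> carrier G" "h \<in> H" "z \<in> N" for x h z
  proof (rule equalityI[OF sub[OF xhz]])
    have "x = x \<otimes> h \<otimes> z \<otimes> inv h \<otimes> inv z" using xhz by (simp add: reassoc)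
    then show "C x \<subseteq> C (x \<otimes> h \<otimes> z)"
      using sub[of "x \<otimes> h \<otimes> z" "inv h" "inv z"] xhz by simp
  qed
  \<comment> \<open>The choice is made from the set \<open>C x\<close>, so \<open>r\<close> is
    constant on each coset.\<close>
  define r where "r x = (SOME y. y \<in> C x)" for x
  have self: "x \<in> C x" if "x \<in> carrier G" for x
    unfolding C_def using that by (intro CollectI exI[of _ \<one>]) simp
  have r: "r x \<in> C x" if "x \<in> carrier G" for x
    unfolding r_def using self[OF that] by (rule someI)
  have rG: "r x \<in> carrier G" if "x \<in> carrier G" for x
    using r[OF that] that by (auto simp: C_def)
  define P where "P x z \<longleftrightarrow> z \<in> N \<and> (\<exists>h \<in> H. x = r x \<otimes> h \<otimes> z)" for x z
  have ex: "\<exists>z. P x z" if x: "x \<in> carrier G" for x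
  proof -
    obtain h z where hz: "r x = x \<otimes> h \<otimes> z" "h \<in> H" "z \<in> N" using r[OF x] by (auto simp: C_def)
    then have "x = r x \<otimes> inv h \<otimes> inv z" using x by (simp add: reassoc)
    then show ?thesis using hz unfolding P_def by (metis Hc(2) N_closed(2))
  qed
  have uniq: "z = z'" if x: "x \<in> carrier G" and Pz: "P x z" "P x z'" for x z z'
  proof -
    obtain h h' where h: "h \<in> H" "x = r x \<otimes> h \<otimes> z" "h' \<in> H" "x = r x \<otimes> h' \<otimes> z'"
      "z \<in> N" "z' \<in> N" using Pz unfolding P_def by blast
    have "r x \<otimes> h \<otimes> z = r x \<otimes> h' \<otimes> z'" by (rule trans[OF h(2)[symmetric] h(4)])
    then have e: "h \<otimes> z = h' \<otimes> z'" using h(1,3,5,6) rG[OF x] by (simp add: m_assoc)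
    \<comment> \<open>Two decompositions of \<open>x\<close> differ by an element lying in both
      \<open>H\<close> and \<open>N\<close>.\<close>
    then have "inv h' \<otimes> h = z' \<otimes> inv z"
      using h(1,3,5,6) by (metis HG N_carrier inv_closed inv_solve_left inv_solve_right m_assoc m_closed)
    then have "z' \<otimes> inv z \<in> H \<inter> N" using h(1,3,5,6) by (metis Hc IntI N_closed(1,2))
    then have "z' \<otimes> inv z = \<one>" using HN by blast
    then show ?thesis using h(5,6) by (metis N_carrier inv_equality inv_inv inv_closed)
  qed
  define \<phi> where "\<phi> = (\<lambda>x \<in> carrier G. SOME z. P x z)"
  have P: "P x (\<phi> x)" if "x \<in> carrier G" for x
    unfolding \<phi>_def using that someI_ex[OF ex[OF that]] by simp
  have \<phi>I: "\<phi> x = z" if "x \<in> carrier G" "P x z" for x z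
    using uniq[OF that(1) P[OF that(1)] that(2)] .
  have \<phi>N: "\<phi> x \<in> N" if "x \<in> carrier G" for x using P[OF that] by (simp add: P_def)
  have step: "\<phi> (x \<otimes> h \<otimes> z) = \<phi> x \<otimes> z" if x: "x \<in> carrier G" and hz: "h \<in> H" "z \<in> N" for x h z
  proof (rule \<phi>I)
    show "x \<otimes> h \<otimes> z \<in> carrier G" using x hz by simp
    obtain h' where h': "h' \<in> H" "x = r x \<otimes> h' \<otimes> \<phi> x" using P[OF x] by (auto simp: P_def)
    have "r (x \<otimes> h \<otimes> z) = r x" by (simp add: r_def Ceq x hz)
    moreover have "x \<otimes> h \<otimes> z = r x \<otimes> (h' \<otimes> h) \<otimes> (\<phi> x \<otimes> z)"
      using h' hz rG[OF x] \<phi>N[OF x] reassoc[of "r x" h' h "\<phi> x" z] by metis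
    ultimately show "P (x \<otimes> h \<otimes> z) (\<phi> x \<otimes> z)"
      unfolding P_def using h'(1) hz \<phi>N[OF x]
      by (intro conjI bexI[of _ "h' \<otimes> h"]) simp_all
  qed
  have inv: "\<phi> (x \<otimes> h) = \<phi> x" if "x \<in> carrier G" "h \<in> H" for x h
    using step[of x h \<one>] that \<phi>N[of x] by simp
  have equiv: "\<phi> (x \<otimes> z) = \<phi> x \<otimes> z" if "x \<in> carrier G" "z \<in> N" for x z
    using step[of x \<one> z] that by simp
  \<comment> \<open>By equivariance the ratio of \<phi> at \<open>x \<otimes> z\<close> and
    \<open>x\<close> is \<open>z\<close> itself, independent of \<open>x\<close>.\<close>
  have "\<phi> (x \<otimes> z) \<otimes> \<phi> y = \<phi> (y \<otimes> z) \<otimes> \<phi> x"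
    if "x \<in> carrier G" "y \<in> carrier G" "z \<in> N" for x y z
  proof -
    have "\<phi> x \<otimes> z \<otimes> \<phi> y = \<phi> y \<otimes> (\<phi> x \<otimes> z)" using that \<phi>N by (intro N_comm) auto
    also have "\<dots> = \<phi> y \<otimes> z \<otimes> \<phi> x" using that \<phi>N N_comm[of z "\<phi> x"] by (simp add: m_assoc)
    finally show ?thesis using that by (simp add: equiv)
  qed
  then have "\<phi> \<in> shift_maps G N"
    using \<phi>N by (auto simp: shift_maps_def) (simp add: \<phi>_def)
  then show thesis using that inv equiv by blast
qed

text \<open>The maps are the embedding of \<open>G\<close> with trivial first component and its
  conjugate by \<open>(\<phi>, \<one>)\<close>. They agree at \<open>g\<close> exactly when right
  translation by \<open>g\<close> fixes \<phi>; elements of \<open>H\<close> do this, while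
  \<open>z\<close> in \<open>N\<close> multiplies \<phi> by \<open>z\<close>.\<close>

lemma separating_homs:
  assumes H: "subgroup H G" and HN: "H \<inter> N = {\<one>}"
  obtains f\<^sub>1 f\<^sub>2 where "f\<^sub>1 \<in> hom G K" "f\<^sub>2 \<in> hom G K" "\<And>h. h \<in> H \<Longrightarrow> f\<^sub>1 h = f\<^sub>2 h"
    "\<And>z. z \<in> N \<Longrightarrow> f\<^sub>1 z = f\<^sub>2 z \<Longrightarrow> z = \<one>"
proof -
  obtain \<phi> where \<phi>: "\<phi> \<in> shift_maps G N"
    and \<phi>H: "\<And>x h. x \<in> carrier G \<Longrightarrow> h \<in> H \<Longrightarrow> \<phi> (x \<otimes> h) = \<phi> x"
    and \<phi>N: "\<And>x z. x \<in> carrier G \<Longrightarrow> z \<in> N \<Longrightarrow> \<phi> (x \<otimes> z) = \<phi> x \<otimes> z"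
    using shift_map_exists[OF H HN] by blast
  define t where "t = (\<phi>, \<one>)"
  have t: "t \<in> carrier K" using \<phi> by (simp add: t_def shift_group_simps)
  define f\<^sub>1 where "f\<^sub>1 = (\<lambda>g :: 'a. (\<lambda>x \<in> carrier G. \<one>, g))"
  define f\<^sub>2 where "f\<^sub>2 g = t \<otimes>\<^bsub>K\<^esub> f\<^sub>1 g \<otimes>\<^bsub>K\<^esub> inv\<^bsub>K\<^esub> t" for g
  interpret f: group_hom G K f\<^sub>1
    using embed_hom by (simp add: group_hom_def group_hom_axioms_def K.is_group is_group f\<^sub>1_def)
  have "f\<^sub>2 \<in> hom G K"
  proof (rule homI)
    show "f\<^sub>2 x \<in> carrier K" if "x \<in> carrier G" for x
      using that t by (simp add: f\<^sub>2_def)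
    show "f\<^sub>2 (x \<otimes> y) = f\<^sub>2 x \<otimes>\<^bsub>K\<^esub> f\<^sub>2 y" if "x \<in> carrier G" "y \<in> carrier G" for x y
    proof -
      have "inv\<^bsub>K\<^esub> t \<otimes>\<^bsub>K\<^esub> (t \<otimes>\<^bsub>K\<^esub> u) = u" if "u \<in> carrier K" for u
        using that t by (simp flip: K.m_assoc)
      then show ?thesis using that t by (simp add: f\<^sub>2_def K.m_assoc)
    qed
  qed
  moreover have eq_iff: "f\<^sub>1 g = f\<^sub>2 g \<longleftrightarrow> (\<forall>x \<in> carrier G. \<phi> (x \<otimes> g) = \<phi> x)"
    if g: "g \<in> carrier G" for g
  proof -
    have "f\<^sub>1 g = f\<^sub>2 g \<longleftrightarrow> f\<^sub>1 g \<otimes>\<^bsub>K\<^esub> t = t \<otimes>\<^bsub>K\<^esub> f\<^sub>1 g"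
      using t f.hom_closed[OF g] unfolding f\<^sub>2_def by (metis K.inv_solve_right K.m_closed)
    also have "\<dots> \<longleftrightarrow> (\<lambda>x \<in> carrier G. \<phi> (x \<otimes> g)) = (\<lambda>x \<in> carrier G. \<phi> x)"
    proof -
      have "f\<^sub>1 g \<otimes>\<^bsub>K\<^esub> t = (\<lambda>x \<in> carrier G. \<phi> (x \<otimes> g), g)"
        using g shift_maps_carrier[OF \<phi>]
        by (simp add: f\<^sub>1_def t_def shift_group_simps cong: restrict_cong)
      moreover have "t \<otimes>\<^bsub>K\<^esub> f\<^sub>1 g = (\<lambda>x \<in> carrier G. \<phi> x, g)"
        using g shift_maps_carrier[OF \<phi>]
        by (simp add: f\<^sub>1_def t_def shift_group_simps cong: restrict_cong)
      ultimately show ?thesis by simp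
    qed
    also have "\<dots> \<longleftrightarrow> (\<forall>x \<in> carrier G. \<phi> (x \<otimes> g) = \<phi> x)"
      by (auto simp: fun_eq_iff restrict_def)
    finally show ?thesis .
  qed
  moreover have "f\<^sub>1 h = f\<^sub>2 h" if "h \<in> H" for h
    using eq_iff[of h] \<phi>H that subgroup.mem_carrier[OF H] by blast
  moreover have "z = \<one>" if "z \<in> N" "f\<^sub>1 z = f\<^sub>2 z" for z
  proof -
    have "\<phi> (\<one> \<otimes> z) = \<phi> \<one>" using eq_iff[of z] that N_carrier one_closed by blast
    then have "\<phi> \<one> \<otimes> z = \<phi> \<one>" using \<phi>N[of \<one> z] that by simp
    then show ?thesis using that shift_maps_carrier[OF \<phi> one_closed] by simp
  qed
  ultimately show thesis using that f.homh by blast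
qed

end

section \<open>Centralizers and adjoining torsion elements to finite subgroups\<close>

context group
begin

lemma subgroup_centralizer:
  assumes x: "x \<in> carrier G"
  shows "subgroup {y \<in> carrier G. y \<otimes> x = x \<otimes> y} G"
proof (rule subgroupI)
  show "inv y \<in> {y \<in> carrier G. y \<otimes> x = x \<otimes> y}" if "y \<in> {y \<in> carrier G. y \<otimes> x = x \<otimes> y}" for y
    using that x by simp (metis inv_closed inv_solve_left inv_solve_right m_assoc m_closed)
  show "y \<otimes> z \<in> {y \<in> carrier G. y \<otimes> x = x \<otimes> y}"
    if "y \<in> {y \<in> carrier G. y \<otimes> x = x \<otimes> y}" "z \<in> {y \<in> carrier G. y \<otimes> x = x \<otimes> y}" for y z
    using that x by simp (metis m_assoc)
qed (use x in auto)

text \<open>The centralizer of \<open>x\<close> is a subgroup, so it is everything once it contains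
  \<open>S\<close>.\<close>

lemma commuting_with_generators_central:
  assumes S: "S \<subseteq> carrier G" "generate G S = carrier G" and x: "x \<in> carrier G"
    and comm: "\<And>s. s \<in> S \<Longrightarrow> s \<otimes> x = x \<otimes> s"
  shows "x \<in> center G"
proof -
  have "generate G S \<subseteq> {y \<in> carrier G. y \<otimes> x = x \<otimes> y}"
    by (rule generate_subgroup_incl[OF _ subgroup_centralizer[OF x]]) (use S(1) comm in auto)
  then show ?thesis using S(2) x by (auto simp: center_def)
qed

lemma commutator_eq_one_iff:
  assumes "x \<in> carrier G" "y \<in> carrier G"
  shows "x \<otimes> y \<otimes> inv x \<otimes> inv y = \<one> \<longleftrightarrow> x \<otimes> y = y \<otimes> x"
proof -
  have "x \<otimes> y \<otimes> inv x \<otimes> inv y = (x \<otimes> y) \<otimes> inv (y \<otimes> x)"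
    using assms by (simp add: m_assoc inv_mult_group)
  then show ?thesis using assms by (metis inv_closed inv_equality inv_inv m_closed r_inv)
qed

lemma finite_generate_singleton:
  assumes s: "s \<in> carrier G" and n: "s [^] (n :: nat) = \<one>" "n > 0"
  shows "finite (generate G {s})"
proof -
  have "ord s dvd n" using n(1) s pow_eq_id by blast
  then have "ord s \<noteq> 0" using n(2) by auto
  then show ?thesis using generate_pow_card[OF s] card_ge_0_finite by force
qed

text \<open>This is the inductive step of the finiteness arguments: normality of \<open>P\<close>
  makes the product with the finite cyclic group of \<open>s\<close> a subgroup, and it is an image
  of a finite product set.\<close>

lemma finite_subgroup_insert:
  assumes P: "P \<lhd> G" "finite P" and s: "s \<in> carrier G" and n: "s [^] (n :: nat) = \<one>" "n > 0"
  shows "subgroup (P <#> generate G {s}) G" "finite (P <#> generate G {s})"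
    "insert s P \<subseteq> P <#> generate G {s}"
proof -
  have gen: "subgroup (generate G {s}) G" using s by (intro generate_is_subgroup) simp
  show "subgroup (P <#> generate G {s}) G"
    by (rule second_isomorphism_grp.normal_set_mult_subgroup)
      (simp add: second_isomorphism_grp_def second_isomorphism_grp_axioms_def P(1) gen)
  have "P <#> generate G {s} = (\<lambda>(x, y). x \<otimes> y) ` (P \<times> generate G {s})"
    by (auto simp: set_mult_def)
  then show "finite (P <#> generate G {s})"
    using P(2) finite_generate_singleton[OF s n] by simp
  have subP: "subgroup P G" using P(1) normal_imp_subgroup by blast
  have "x \<in> P <#> generate G {s}" if "x \<in> P" for x
  proof -
    have "x \<otimes> \<one> \<in> P <#> generate G {s}"
      unfolding set_mult_def using that generate.one[of G "{s}"] by blast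
    then show ?thesis using that subgroup.mem_carrier[OF subP] by simp
  qed
  moreover have "\<one> \<otimes> s \<in> P <#> generate G {s}"
    unfolding set_mult_def using subgroup.one_closed[OF subP] generate.incl[of s "{s}" G] by blast
  ultimately show "insert s P \<subseteq> P <#> generate G {s}" using s by auto
qed

text \<open>Elements of \<open>T\<close> are adjoined one at a time; the subgroup built so far is
  central, hence normal.\<close>

lemma finite_central_subgroup:
  assumes "finite T" "T \<subseteq> center G" "\<And>x. x \<in> carrier G \<Longrightarrow> \<exists>n > 0. x [^] (n :: nat) = \<one>"
  shows "\<exists>C. subgroup C G \<and> finite C \<and> C \<subseteq> center G \<and> T \<subseteq> C"
  using assms(1,2)
proof (induction T)
  case empty
  then show ?case using triv_subgroup subgroup.one_closed[OF subgroup_center]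
    by (intro exI[of _ "{\<one>}"]) auto
next
  case (insert t T)
  then obtain C where C: "subgroup C G" "finite C" "C \<subseteq> center G" "T \<subseteq> C" by auto
  have t: "t \<in> center G" "t \<in> carrier G" using insert.prems centerD by auto
  obtain n :: nat where n: "t [^] n = \<one>" "n > 0" using assms(3)[OF t(2)] by blast
  note C' = finite_subgroup_insert[OF central_subgroup_normal[OF C(1,3)] C(2) t(2) n]
  have "generate G {t} \<subseteq> center G"
    by (rule generate_subgroup_incl[OF _ subgroup_center]) (use t in simp)
  then have "C <#> generate G {t} \<subseteq> center G"
    unfolding set_mult_def using C(3) subgroup.m_closed[OF subgroup_center] by blast
  moreover have "insert t T \<subseteq> C <#> generate G {t}" using C'(3) C(4) by blast
  ultimately show ?case using C'(1,2) by blast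
qed

end

section \<open>Commutator calculus and finiteness in class two\<close>

locale class2_group = group G for G (structure) +
  assumes derived_central: "derived G (carrier G) \<subseteq> center G"
begin

definition bracket where "bracket x y = x \<otimes> y \<otimes> inv x \<otimes> inv y"

lemma bracket_central: "x \<in> carrier G \<Longrightarrow> y \<in> carrier G \<Longrightarrow> bracket x y \<in> center G"
  unfolding bracket_def using commutator_mem_derived derived_central by blast

lemma bracket_closed [simp]: "x \<in> carrier G \<Longrightarrow> y \<in> carrier G \<Longrightarrow> bracket x y \<in> carrier G"
  by (simp add: bracket_def)

text \<open>The central factor \<open>bracket y s\<close> moves out of the conjugation by
  \<open>x\<close>.\<close>

lemma bracket_mult:
  assumes x: "x \<in> carrier G" and y: "y \<in> carrier G" and s: "s \<in> carrier G"
  shows "bracket (x \<otimes> y) s = bracket x s \<otimes> bracket y s"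
proof -
  have "bracket (x \<otimes> y) s = x \<otimes> bracket y s \<otimes> (s \<otimes> inv x \<otimes> inv s)"
    using x y s by (simp add: bracket_def m_assoc inv_mult_group)
      (simp flip: m_assoc)
  also have "\<dots> = bracket y s \<otimes> bracket x s"
    using x y s center_comm[OF bracket_central[OF y s] x, symmetric]
    by (simp add: bracket_def[of x] m_assoc)
  also have "\<dots> = bracket x s \<otimes> bracket y s"
    using x y s by (simp add: center_comm bracket_central)
  finally show ?thesis .
qed

lemma bracket_one: "s \<in> carrier G \<Longrightarrow> bracket \<one> s = \<one>"
  by (simp add: bracket_def)

lemma bracket_pow:
  assumes "x \<in> carrier G" "s \<in> carrier G"
  shows "bracket (x [^] (n :: nat)) s = bracket x s [^] n"
  using assms by (induction n) (simp_all add: bracket_one bracket_mult)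

lemma bracket_inv:
  assumes "x \<in> carrier G" "s \<in> carrier G"
  shows "bracket (inv x) s = inv (bracket x s)"
proof -
  have "bracket (inv x) s \<otimes> bracket x s = \<one>"
    using assms bracket_mult[of "inv x" x s] by (simp add: bracket_one)
  then show ?thesis using assms by (intro inv_equality[symmetric]) simp_all
qed

lemma bracket_swap:
  assumes "x \<in> carrier G" "y \<in> carrier G"
  shows "bracket y x = inv (bracket x y)"
  using assms by (simp add: bracket_def inv_mult_group m_assoc)

text \<open>Each \<open>bracket x s\<close> is central, hence killed by a power of \<open>p\<close>.
  As the bracket turns powers of \<open>x\<close> into powers of the bracket, some
  \<open>p\<close>-power of \<open>x\<close> commutes with all the finitely many generators. It is
  therefore central and itself killed by a power of \<open>p\<close>.\<close>

lemma p_group_if_center: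
  assumes S: "finite S" "S \<subseteq> carrier G" "generate G S = carrier G"
    and Z: "\<And>z. z \<in> center G \<Longrightarrow> \<exists>k. z [^] (p ^ k :: nat) = \<one>"
  shows "p_group p G"
  unfolding p_group_def
proof
  fix x assume x: "x \<in> carrier G"
  have "\<forall>s \<in> S. \<exists>k. bracket x s [^] (p ^ k) = \<one>"
    using Z bracket_central x S(2) by blast
  then obtain k where k: "\<And>s. s \<in> S \<Longrightarrow> bracket x s [^] (p ^ k s) = \<one>" by metis
  \<comment> \<open>The sum serves as a common upper bound for all the exponents
    \<open>k s\<close>.\<close>
  define m where "m = (\<Sum>s \<in> S. k s)"
  have "x [^] (p ^ m) \<in> center G"
  proof (rule commuting_with_generators_central[OF S(2,3)])
    show "x [^] (p ^ m) \<in> carrier G" using x by simp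
    fix s assume s: "s \<in> S"
    then have sG: "s \<in> carrier G" using S(2) by blast
    have "k s \<le> m" unfolding m_def using s S(1) by (intro member_le_sum) auto
    then have "p ^ m = p ^ k s * p ^ (m - k s)" by (simp flip: power_add)
    then have "bracket x s [^] (p ^ m) = \<one>"
      using k[OF s] x sG by (simp flip: nat_pow_pow)
    then have "bracket (x [^] (p ^ m)) s = \<one>" using x sG by (simp add: bracket_pow)
    then show "s \<otimes> x [^] (p ^ m) = x [^] (p ^ m) \<otimes> s"
      using x sG by (simp add: bracket_def commutator_eq_one_iff)
  qed
  then obtain j where "(x [^] (p ^ m)) [^] (p ^ j) = \<one>" using Z by blast
  then have "x [^] (p ^ (m + j)) = \<one>" using x by (simp add: nat_pow_pow power_add)
  then show "\<exists>k. x [^] (p ^ k) = \<one>" by blast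
qed

lemma subgroup_bracket_mem:
  assumes C: "subgroup C G" and y: "y \<in> carrier G"
  shows "subgroup {x \<in> carrier G. bracket x y \<in> C} G"
proof (rule subgroupI)
  have "\<one> \<in> {x \<in> carrier G. bracket x y \<in> C}"
    using y subgroup.one_closed[OF C] by (simp add: bracket_one)
  then show "{x \<in> carrier G. bracket x y \<in> C} \<noteq> {}" by blast
qed (use y in \<open>auto simp: bracket_inv bracket_mult subgroup.m_inv_closed[OF C] subgroup.m_closed[OF C]\<close>)

text \<open>For a fixed second argument the bracket is multiplicative, so membership extends from
  generators to all first arguments. Swapping the arguments inverts the bracket, and a second
  extension treats the other argument.\<close>

lemma bracket_mem_if_generators:
  assumes S: "S \<subseteq> carrier G" "generate G S = carrier G" and C: "subgroup C G"
    and ST: "\<And>s t. s \<in> S \<Longrightarrow> t \<in> S \<Longrightarrow> bracket s t \<in> C"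
    and x: "x \<in> carrier G" and y: "y \<in> carrier G"
  shows "bracket x y \<in> C"
proof -
  have ext: "bracket x y \<in> C"
    if y: "y \<in> carrier G" and s: "\<And>s. s \<in> S \<Longrightarrow> bracket s y \<in> C" and x: "x \<in> carrier G" for x y
  proof -
    have "generate G S \<subseteq> {x \<in> carrier G. bracket x y \<in> C}"
      by (rule generate_subgroup_incl[OF _ subgroup_bracket_mem[OF C y]]) (use s S(1) in auto)
    then show ?thesis using S(2) x by blast
  qed
  have "bracket s y \<in> C" if s: "s \<in> S" for s
  proof -
    have sG: "s \<in> carrier G" using s S(1) by blast
    have "bracket y s \<in> C" using ext[OF sG] ST s y by blast
    then show ?thesis using bracket_swap[OF y sG] subgroup.m_inv_closed[OF C] by simp
  qed
  then show ?thesis using ext[OF y _ x] by blast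
qed

text \<open>The brackets of generators lie in a finite central subgroup \<open>C\<close>, which then
  contains every commutator. Any subgroup above \<open>C\<close> is normal, so the generators can be
  adjoined one by one while keeping the subgroup finite.\<close>

lemma finite_if_torsion_generators:
  assumes S: "finite S" "S \<subseteq> carrier G" "generate G S = carrier G"
    and tors: "\<And>x. x \<in> carrier G \<Longrightarrow> \<exists>n > 0. x [^] (n :: nat) = \<one>"
  shows "finite (carrier G)"
proof -
  let ?T = "(\<lambda>(s, t). bracket s t) ` (S \<times> S)"
  have "?T \<subseteq> center G" using S(2) bracket_central by auto
  then obtain C where C: "subgroup C G" "finite C" "C \<subseteq> center G" "?T \<subseteq> C"
    using finite_central_subgroup[of ?T] S(1) tors by auto
  have brC: "bracket x y \<in> C" if "x \<in> carrier G" "y \<in> carrier G" for x y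
    by (rule bracket_mem_if_generators[OF S(2,3) C(1) _ that]) (use C(4) in auto)
  have "\<exists>P. subgroup P G \<and> finite P \<and> C \<subseteq> P \<and> U \<subseteq> P" if "finite U" "U \<subseteq> carrier G" for U
    using that
  proof (induction U)
    case empty
    then show ?case using C by blast
  next
    case (insert s U)
    then obtain P where P: "subgroup P G" "finite P" "C \<subseteq> P" "U \<subseteq> P" by auto
    have s: "s \<in> carrier G" using insert.prems by simp
    obtain n :: nat where n: "s [^] n = \<one>" "n > 0" using tors[OF s] by blast
    have "P \<lhd> G"
      unfolding normal_inv_iff
    proof (intro conjI ballI P(1))
      fix x q assume x: "x \<in> carrier G" and q: "q \<in> P"
      have qG: "q \<in> carrier G" using q subgroup.mem_carrier[OF P(1)] by blast
      have "x \<otimes> q \<otimes> inv x = bracket x q \<otimes> q" using x qG by (simp add: bracket_def m_assoc)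
      then show "x \<otimes> q \<otimes> inv x \<in> P"
        using brC[OF x qG] P(3) q subgroup.m_closed[OF P(1)] by auto
    qed
    note P' = finite_subgroup_insert[OF this P(2) s n]
    have "C \<subseteq> P <#> generate G {s}" "insert s U \<subseteq> P <#> generate G {s}"
      using P'(3) P(3,4) by auto
    then show ?case using P'(1,2) by blast
  qed
  then obtain P where P: "subgroup P G" "finite P" "S \<subseteq> P" using S(1,2) by blast
  have "carrier G \<subseteq> P" using generate_subgroup_incl[OF P(3,1)] S(3) by simp
  then show ?thesis using P(2) finite_subset by blast
qed

end

section \<open>The prime belonging to a monolithic centre\<close>

context group
begin

text \<open>Every nontrivial central element has \<open>z\<close> as a power, so a prime dividing
  the order of \<open>z\<close> divides the order of each of them. Hence no other prime can
  occur.\<close>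

lemma center_p_torsion_if_monolithic:
  assumes z: "z \<in> center G" "z \<noteq> \<one>"
    and min: "\<And>x. x \<in> center G \<Longrightarrow> x \<noteq> \<one> \<Longrightarrow> z \<in> generate G {x}"
  obtains p where "prime p" "\<And>x. x \<in> center G \<Longrightarrow> \<exists>k. x [^] (p ^ k :: nat) = \<one>"
proof -
  have zG: "z \<in> carrier G" using z centerD by blast
  have pw: "\<exists>m :: int. z = x [^] m" if "x \<in> center G" "x \<noteq> \<one>" for x
    using min[OF that] generate_pow[OF centerD[OF that(1)]] by blast
  have pow_center: "x [^] n \<in> center G" if "x \<in> center G" for x and n :: nat
    using that subgroup_center by (induction n) (auto intro: subgroup.m_closed subgroup.one_closed)
  have ord0: "ord z \<noteq> 0"
  proof (cases "z [^] (2 :: nat) = \<one>")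
    case True
    then have "ord z dvd 2" using zG pow_eq_id by blast
    then show ?thesis by (metis dvd_0_left zero_neq_numeral)
  next
    case False
    \<comment> \<open>Here \<open>z\<close> is a power of its own square, so the odd, hence nonzero,
      exponent \<open>2 * m - 1\<close> kills \<open>z\<close>.\<close>
    then obtain m :: int where "z = (z [^] (2 :: nat)) [^] m" using pw[OF pow_center[OF z(1)]] by blast
    then have "z [^] (1 :: int) = z [^] (2 * m)"
      using zG by (metis int_pow_1 int_pow_int int_pow_pow of_nat_numeral)
    then have "z [^] (2 * m - 1) = \<one>" using zG by (metis int_pow_diff int_pow_closed r_inv)
    then have "int (ord z) dvd 2 * m - 1" using zG int_pow_eq_id by blast
    moreover have "2 * m - 1 \<noteq> 0" by presburger
    ultimately show ?thesis by (metis dvd_0_left of_nat_0)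
  qed
  have "ord z \<noteq> 1" using z(2) ord_eq_1[OF zG] by simp
  then obtain p where p: "prime p" "p dvd ord z" using prime_factor_nat by blast
  have "\<exists>k. x [^] (p ^ k) = \<one>" if x: "x \<in> center G" for x
  proof (cases "x = \<one>")
    case False
    have xG: "x \<in> carrier G" using x centerD by blast
    have ordx: "ord z dvd n" if n: "y [^] n = \<one>" and y: "y \<in> center G" "y \<noteq> \<one>" for y and n :: nat
    proof -
      obtain m :: int where m: "z = y [^] m" using pw y by blast
      have yG: "y \<in> carrier G" using y centerD by blast
      have "z [^] int n = (y [^] int n) [^] m"
        unfolding m using yG by (simp add: int_pow_pow mult.commute)
      then have "z [^] int n = \<one>" using n by (simp add: int_pow_int int_pow_one)
      then show ?thesis using zG by (simp add: int_pow_int pow_eq_id)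
    qed
    obtain m :: int where m: "z = x [^] m" using pw x False by blast
    have "m \<noteq> 0" using m z(2) by auto
    \<comment> \<open>Finite order passes from \<open>z\<close> back to \<open>x\<close>: a nonzero
      exponent kills \<open>x\<close>.\<close>
    have "x [^] (m * int (ord z)) = z [^] int (ord z)"
      unfolding m using xG by (simp add: int_pow_pow)
    also have "\<dots> = \<one>" using zG by (simp add: int_pow_int)
    finally have "int (ord x) dvd m * int (ord z)" using xG int_pow_eq_id by blast
    then have ordx0: "ord x \<noteq> 0"
      using \<open>m \<noteq> 0\<close> ord0 by (metis dvd_0_left mult_eq_0_iff of_nat_0 of_nat_eq_0_iff)
    obtain r where r: "ord x = p ^ multiplicity p (ord x) * r" "\<not> p dvd r"
      using multiplicity_decompose'[of "ord x" p] ordx0 p(1) by (metis not_prime_unit)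
    \<comment> \<open>This element is killed by \<open>r\<close>, which \<open>p\<close> does not
      divide. If it were nontrivial, \<open>ord z\<close> and with it \<open>p\<close> would divide
      \<open>r\<close>.\<close>
    let ?y = "x [^] (p ^ multiplicity p (ord x))"
    have "?y = \<one>"
    proof (rule ccontr)
      assume "?y \<noteq> \<one>"
      moreover have "?y \<in> center G"
        using x by (rule pow_center)
      moreover have "?y [^] r = \<one>" using xG r(1) by (metis nat_pow_pow pow_ord_eq_1)
      ultimately have "ord z dvd r" using ordx by blast
      then show False using p(2) r(2) dvd_trans by blast
    qed
    then show ?thesis by blast
  qed (auto intro: exI[of _ 0])
  then show thesis using that p(1) by blast
qed

end

lemma class2_group_if_nilpotent:
  assumes G: "nilpotent_class_le 2 G"
  shows "class2_group G"
proof -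
  interpret group G using G by (simp add: nilpotent_class_le_def)
  show ?thesis
  proof
    show "derived G (carrier G) \<subseteq> center G"
    proof
      fix d assume d: "d \<in> derived G (carrier G)"
      have dG: "d \<in> carrier G" using d derived_in_carrier by blast
      have "d \<otimes>\<^bsub>G\<^esub> x = x \<otimes>\<^bsub>G\<^esub> d" if x: "x \<in> carrier G" for x
      proof -
        have "d \<otimes>\<^bsub>G\<^esub> x \<otimes>\<^bsub>G\<^esub> inv\<^bsub>G\<^esub> d \<otimes>\<^bsub>G\<^esub> inv\<^bsub>G\<^esub> x
            \<in> commutator_subgroup G (derived G (carrier G)) (carrier G)"
          unfolding commutator_subgroup_def by (rule generate.incl) (use d x in blast)
        then show ?thesis
          using G commutator_eq_one_iff[OF dG x] by (simp add: nilpotent_class_le_2_iff)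
      qed
      then show "d \<in> center G" using dG by (simp add: center_def)
    qed
  qed
qed

section \<open>Abelian test groups and maximal normal subgroups avoiding a set\<close>

context group
begin

lemma metabelian_nilpotent_if_derived_trivial:
  assumes "derived G (carrier G) = {\<one>}"
  shows "metabelian_nilpotent G"
proof -
  have "derived G {\<one>} \<subseteq> {\<one>}" by (rule derived_incl[OF subset_refl triv_subgroup])
  then have "derived G {\<one>} = {\<one>}" using generate.one unfolding derived_def by fast
  moreover have "lower_central G 1 = {\<one>}" using assms by (simp add: commutator_subgroup_self)
  ultimately show ?thesis
    using assms is_group unfolding metabelian_nilpotent_def metabelian_group_def
      nilpotent_group_def nilpotent_class_le_def by metis
qed

text \<open>Zorn's lemma applies because the union of a nonempty chain of normal subgroups avoiding
  \<open>A\<close> is again one: any two elements of the union already lie in a common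
  member.\<close>

lemma maximal_normal_avoiding:
  assumes "\<one> \<notin> A"
  obtains L where "L \<lhd> G" "L \<inter> A = {}" "\<And>M. M \<lhd> G \<Longrightarrow> L \<subset> M \<Longrightarrow> M \<inter> A \<noteq> {}"
proof -
  let ?\<A> = "{L. L \<lhd> G \<and> L \<inter> A = {}}"
  have "\<exists>L \<in> ?\<A>. \<forall>X \<in> ?\<A>. L \<subseteq> X \<longrightarrow> X = L"
  proof (rule subset_Zorn_nonempty)
    show "?\<A> \<noteq> {}" using one_is_normal assms by blast
    fix \<C> assume ne: "\<C> \<noteq> {}" and chain: "subset.chain ?\<A> \<C>"
    have sub: "X \<lhd> G" "X \<inter> A = {}" if "X \<in> \<C>" for X
      using chain that by (auto simp: subset.chain_def)
    have lin: "X \<subseteq> Y \<or> Y \<subseteq> X" if "X \<in> \<C>" "Y \<in> \<C>" for X Y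
      using chain that unfolding subset.chain_def by blast
    have sg: "subgroup X G" if "X \<in> \<C>" for X using sub(1)[OF that] normal_imp_subgroup by blast
    have "\<Union>\<C> \<lhd> G"
      unfolding normal_inv_iff
    proof (intro conjI ballI subgroupI)
      show "\<Union>\<C> \<subseteq> carrier G" using sg subgroup.subset by blast
      show "\<Union>\<C> \<noteq> {}" using ne sg subgroup.one_closed by blast
      show "inv a \<in> \<Union>\<C>" if a: "a \<in> \<Union>\<C>" for a
      proof -
        obtain X where X: "X \<in> \<C>" "a \<in> X" using a by blast
        then show ?thesis using subgroup.m_inv_closed[OF sg[OF X(1)]] by blast
      qed
      show "a \<otimes> b \<in> \<Union>\<C>" if ab: "a \<in> \<Union>\<C>" "b \<in> \<Union>\<C>" for a b
      proof -
        obtain X where X: "X \<in> \<C>" "a \<in> X" "b \<in> X" using ab lin by blast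
        then show ?thesis using subgroup.m_closed[OF sg[OF X(1)]] by blast
      qed
      show "x \<otimes> a \<otimes> inv x \<in> \<Union>\<C>" if x: "x \<in> carrier G" and a: "a \<in> \<Union>\<C>" for x a
      proof -
        obtain X where X: "X \<in> \<C>" "a \<in> X" using a by blast
        then show ?thesis using normal.inv_op_closed2[OF sub(1)[OF X(1)] x X(2)] by blast
      qed
    qed
    then show "\<Union>\<C> \<in> ?\<A>" using sub(2) by blast
  qed
  then obtain L where L: "L \<in> ?\<A>" and max: "\<forall>X \<in> ?\<A>. L \<subseteq> X \<longrightarrow> X = L" by (rule bexE)
  show thesis
  proof (rule that)
    show "L \<lhd> G" "L \<inter> A = {}" using L by simp_all
    show "M \<inter> A \<noteq> {}" if "M \<lhd> G" "L \<subset> M" for M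
    proof
      assume "M \<inter> A = {}"
      then have "M \<in> ?\<A>" using that(1) by simp
      then have "M = L" using max that(2) by simp
      then show False using that(2) by simp
    qed
  qed
qed

end

section \<open>The monolithic case\<close>

context class2_group
begin

lemma not_in_dominion_if_monolithic:
  assumes fg: "finitely_generated_group G" and H: "subgroup H G"
    and g: "g \<in> carrier G" "g \<notin> H"
    and mono: "\<And>M. M \<lhd> G \<Longrightarrow> M \<noteq> {\<one>} \<Longrightarrow> \<exists>h \<in> H. \<exists>m \<in> M. g = h \<otimes> m"
  shows "g \<notin> dominion metabelian_nilpotent G H"
proof
  assume dom: "g \<in> dominion metabelian_nilpotent G H"
  have HG: "h \<in> carrier G" if "h \<in> H" for h using that subgroup.mem_carrier[OF H] by blast
  \<comment> \<open>The intersection is central, hence normal. If it were nontrivial,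
    \<open>mono\<close> would write \<open>g\<close> as a product of two elements of
    \<open>H\<close>.\<close>
  have HZ: "H \<inter> center G = {\<one>}"
  proof (rule ccontr)
    assume "H \<inter> center G \<noteq> {\<one>}"
    moreover have "H \<inter> center G \<lhd> G"
      by (rule central_subgroup_normal[OF subgroups_Inter_pair[OF H subgroup_center]]) blast
    ultimately obtain h m where "h \<in> H" "m \<in> H" "g = h \<otimes> m" using mono by blast
    then show False using g(2) subgroup.m_closed[OF H] by blast
  qed
  let ?N = "derived G (carrier G)"
  show False
  proof (cases "?N = {\<one>}")
    case True
    have "carrier G \<subseteq> center G"
      using commuting_with_generators_central[of "carrier G"] commutator_mem_derived True
        commutator_eq_one_iff generate_incl generate.incl by (auto simp: center_def)
    then have "H = {\<one>}" using HZ HG by blast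
    \<comment> \<open>Both maps agree on the trivial \<open>H\<close>, so membership in the dominion
      forces \<open>g\<close> to be trivial and thus in \<open>H\<close>.\<close>
    moreover have "id g = (\<lambda>_. \<one>) g"
    proof (rule dominion_metabelian_nilpotentD[OF is_group dom])
      show "metabelian_nilpotent G" by (rule metabelian_nilpotent_if_derived_trivial[OF True])
      show "id \<in> hom G G" "(\<lambda>_. \<one>) \<in> hom G G" by (auto simp: hom_def)
      show "id h = \<one>" if "h \<in> H" for h using that \<open>H = {\<one>}\<close> by simp
    qed
    ultimately show False using g(2) by simp
  next
    case False
    have subN: "subgroup ?N G" by (rule derived_is_subgroup) simp
    interpret N: central_subgroup G ?N
      using is_group subN derived_central
      by (simp add: central_subgroup_def central_subgroup_axioms_def)
    obtain h z where hz: "h \<in> H" "z \<in> ?N" "g = h \<otimes> z"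
      using mono[OF central_subgroup_normal[OF subN derived_central] False] by blast
    have z1: "z \<noteq> \<one>" using hz g(2) HG by auto
    have zZ: "z \<in> center G" using hz(2) derived_central by blast
    \<comment> \<open>Comparing the factorizations of \<open>g\<close> through the derived subgroup
      and through \<open>M\<close> gives an element of \<open>H\<close> that is central, hence
      trivial; so the two central factors coincide.\<close>
    have zmem: "z \<in> M" if M: "subgroup M G" "M \<subseteq> center G" "M \<noteq> {\<one>}" for M
    proof -
      obtain h' m where m: "h' \<in> H" "m \<in> M" "g = h' \<otimes> m"
        using mono[OF central_subgroup_normal[OF M(1,2)] M(3)] by blast
      have car: "h \<in> carrier G" "h' \<in> carrier G" "m \<in> carrier G" "z \<in> carrier G"
        using m hz HG M(2) centerD zZ by blast+
      have "h \<otimes> z = h' \<otimes> m" using hz(3) m(3) by simp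
      then have e: "inv h' \<otimes> h = m \<otimes> inv z"
        using car by (metis inv_closed inv_solve_left inv_solve_right m_assoc m_closed)
      moreover have "inv h' \<otimes> h \<in> H"
        using m(1) hz(1) subgroup.m_closed[OF H] subgroup.m_inv_closed[OF H] by blast
      moreover have "m \<otimes> inv z \<in> center G"
        using m(2) M(2) zZ subgroup.m_closed[OF subgroup_center]
          subgroup.m_inv_closed[OF subgroup_center] by blast
      ultimately have "m \<otimes> inv z = \<one>" using HZ by (metis IntI singletonD)
      then have "m = z" using car by (metis inv_equality inv_inv inv_closed)
      then show ?thesis using m(2) by simp
    qed
    have "z \<in> generate G {x}" if x: "x \<in> center G" "x \<noteq> \<one>" for x
    proof (rule zmem)
      show "subgroup (generate G {x}) G" using x centerD by (intro generate_is_subgroup) simp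
      show "generate G {x} \<subseteq> center G"
        by (rule generate_subgroup_incl[OF _ subgroup_center]) (use x in simp)
      show "generate G {x} \<noteq> {\<one>}" using x(2) generate.incl[of x "{x}" G] by blast
    qed
    then obtain p where p: "prime p" "\<And>x. x \<in> center G \<Longrightarrow> \<exists>k. x [^] (p ^ k :: nat) = \<one>"
      using center_p_torsion_if_monolithic[OF zZ z1] by blast
    obtain S where S: "finite S" "S \<subseteq> carrier G" "generate G S = carrier G"
      using fg by (auto simp: finitely_generated_group_def)
    have pG: "p_group p G" by (rule p_group_if_center[OF S p(2)])
    have fin: "finite (carrier G)"
    proof (rule finite_if_torsion_generators[OF S])
      fix x assume "x \<in> carrier G"
      then obtain k where "x [^] (p ^ k) = \<one>" using pG unfolding p_group_def by blast
      moreover have "p ^ k > 0" using p(1) prime_gt_0_nat by simp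
      ultimately show "\<exists>n > 0. x [^] (n :: nat) = \<one>" by blast
    qed
    have HN: "H \<inter> ?N = {\<one>}" using HZ derived_central subgroup.one_closed[OF subN] by blast
    obtain f\<^sub>1 f\<^sub>2 where f: "f\<^sub>1 \<in> hom G (shift_group G ?N)" "f\<^sub>2 \<in> hom G (shift_group G ?N)"
      "\<And>h. h \<in> H \<Longrightarrow> f\<^sub>1 h = f\<^sub>2 h" "\<And>z. z \<in> ?N \<Longrightarrow> f\<^sub>1 z = f\<^sub>2 z \<Longrightarrow> z = \<one>"
      using N.separating_homs[OF H HN] by blast
    interpret K: group "shift_group G ?N" by (rule N.group_shift_group)
    have "metabelian_nilpotent (shift_group G ?N)"
      unfolding metabelian_nilpotent_def
      using N.metabelian_shift_group[OF subset_refl]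
        K.finite_p_group_nilpotent[OF N.finite_shift_group[OF fin] p(1)
          N.p_group_shift_group[OF fin p(1) pG]] by blast
    then have "f\<^sub>1 g = f\<^sub>2 g"
      using dominion_metabelian_nilpotentD[OF is_group dom _ f(1,2)] f(3) by blast
    moreover have zG: "z \<in> carrier G" using zZ centerD by blast
    \<comment> \<open>As \<open>g\<close> is \<open>h \<otimes> z\<close> and the maps agree on
      \<open>h\<close>, agreement at \<open>g\<close> cancels to agreement at
      \<open>z\<close>.\<close>
    ultimately have "f\<^sub>1 h \<otimes>\<^bsub>shift_group G ?N\<^esub> f\<^sub>1 z = f\<^sub>1 h \<otimes>\<^bsub>shift_group G ?N\<^esub> f\<^sub>2 z"
      using hom_mult[OF f(1) HG[OF hz(1)] zG] hom_mult[OF f(2) HG[OF hz(1)] zG] hz f(3) by metis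
    then have "f\<^sub>1 z = f\<^sub>2 z"
      using hom_in_carrier[OF f(1)] hom_in_carrier[OF f(2)] zG HG[OF hz(1)] by simp
    then show False using f(4)[OF hz(2)] z1 by blast
  qed
qed

end

section \<open>Reduction to a monolithic quotient\<close>

theorem theorem4p17:
  fixes G :: "('a, 'b) monoid_scheme" and H :: "'a set"
  assumes "finitely_generated_group G"
    and "nilpotent_class_le 2 G"
    and "subgroup H G"
  shows "dominion metabelian_nilpotent G H = H"
proof
  show "H \<subseteq> dominion metabelian_nilpotent G H"
    using subgroup.subset[OF assms(3)] by (auto simp: dominion_def)
  show "dominion metabelian_nilpotent G H \<subseteq> H"
  proof (rule subsetI, rule ccontr)
    fix g assume dom: "g \<in> dominion metabelian_nilpotent G H" and gH: "g \<notin> H"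
    interpret class2_group G by (rule class2_group_if_nilpotent[OF assms(2)])
    interpret H: subgroup H G by fact
    have g: "g \<in> carrier G" using dom by (simp add: dominion_def)
    \<comment> \<open>A normal subgroup \<open>L\<close> avoids \<open>A\<close> exactly when
      \<open>g\<close> lies in no coset \<open>h L\<close> with \<open>h\<close> in
      \<open>H\<close>.\<close>
    define A where "A = {inv\<^bsub>G\<^esub> h \<otimes>\<^bsub>G\<^esub> g | h. h \<in> H}"
    have "\<one>\<^bsub>G\<^esub> \<notin> A"
    proof
      assume "\<one>\<^bsub>G\<^esub> \<in> A"
      then obtain h where h: "h \<in> H" "inv\<^bsub>G\<^esub> h \<otimes>\<^bsub>G\<^esub> g = \<one>\<^bsub>G\<^esub>" by (auto simp: A_def)
      then have "g = h" using g by (metis H.mem_carrier inv_closed inv_comm inv_equality inv_inv)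
      then show False using h(1) gH by simp
    qed
    then obtain L where L: "L \<lhd> G" "L \<inter> A = {}"
      "\<And>M. M \<lhd> G \<Longrightarrow> L \<subset> M \<Longrightarrow> M \<inter> A \<noteq> {}" using maximal_normal_avoiding by blast
    interpret L: normal L G by (rule L(1))
    let ?Q = "G Mod L" and ?\<pi> = "\<lambda>a. L #>\<^bsub>G\<^esub> a"
    interpret Q: group ?Q by (rule L.factorgroup_is_group)
    interpret \<pi>: group_hom G ?Q ?\<pi>
      using L.r_coset_hom_Mod by (simp add: group_hom_def group_hom_axioms_def is_group Q.is_group)
    have surj: "carrier ?Q = ?\<pi> ` carrier G" by (auto simp: FactGroup_def RCOSETS_def)
    have fgQ: "finitely_generated_group ?Q"
    proof -
      obtain S where "finite S" "S \<subseteq> carrier G" "generate G S = carrier G"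
        using assms(1) by (auto simp: finitely_generated_group_def)
      then show ?thesis
        unfolding finitely_generated_group_def
        using \<pi>.generate_img[of S] surj Q.is_group by (metis finite_imageI image_mono)
    qed
    interpret Q: class2_group ?Q
    proof
      have eq: "derived ?Q (carrier ?Q) = ?\<pi> ` derived G (carrier G)"
        unfolding surj by (rule \<pi>.derived_img) simp
      have "?\<pi> d \<in> center ?Q" if d: "d \<in> derived G (carrier G)" for d
      proof -
        have dZ: "d \<in> center G" using d derived_central by blast
        have "?\<pi> d \<otimes>\<^bsub>?Q\<^esub> ?\<pi> x = ?\<pi> x \<otimes>\<^bsub>?Q\<^esub> ?\<pi> d" if "x \<in> carrier G" for x
          using \<pi>.hom_mult[of d x] \<pi>.hom_mult[of x d] that center_comm[OF dZ that] centerD[OF dZ]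
          by metis
        then show ?thesis
          unfolding center_def surj using centerD[OF dZ] by blast
      qed
      then show "derived ?Q (carrier ?Q) \<subseteq> center ?Q" unfolding eq by (rule image_subsetI)
    qed
    have "?\<pi> g \<notin> dominion metabelian_nilpotent ?Q (?\<pi> ` H)"
    proof (rule Q.not_in_dominion_if_monolithic[OF fgQ])
      show "subgroup (?\<pi> ` H) ?Q" by (rule \<pi>.subgroup_img_is_subgroup[OF assms(3)])
      show "?\<pi> g \<in> carrier ?Q" using g by simp
      show "?\<pi> g \<notin> ?\<pi> ` H"
      proof
        assume "?\<pi> g \<in> ?\<pi> ` H"
        then obtain h where h: "h \<in> H" "?\<pi> g = ?\<pi> h" by blast
        then have "?\<pi> (inv\<^bsub>G\<^esub> h \<otimes>\<^bsub>G\<^esub> g) = \<one>\<^bsub>?Q\<^esub>"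
          using g \<pi>.hom_mult[of "inv\<^bsub>G\<^esub> h" g] \<pi>.hom_inv[of h] \<pi>.hom_closed[of h]
            Q.l_inv[of "?\<pi> h"] by (simp del: mult_FactGroup one_FactGroup)
        then have "inv\<^bsub>G\<^esub> h \<otimes>\<^bsub>G\<^esub> g \<in> L"
          using rcos_self[OF _ L.subgroup_axioms, of "inv\<^bsub>G\<^esub> h \<otimes>\<^bsub>G\<^esub> g"] h(1) g by simp
        then show False using L(2) h(1) by (auto simp: A_def)
      qed
      fix M assume M: "M \<lhd> ?Q" "M \<noteq> {\<one>\<^bsub>?Q\<^esub>}"
      interpret M: normal M ?Q by (rule M(1))
      \<comment> \<open>The preimage is normal and strictly above \<open>L\<close>, so maximality
        makes it meet \<open>A\<close>; this yields the factorization of the image of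
        \<open>g\<close>.\<close>
      define M' where "M' = {a \<in> carrier G. ?\<pi> a \<in> M}"
      have "M' \<lhd> G" unfolding M'_def by (rule \<pi>.normal_vimage[OF M(1)])
      moreover have "L \<subset> M'"
      proof
        show "L \<subseteq> M'"
        proof
          fix a assume a: "a \<in> L"
          then have "?\<pi> a = \<one>\<^bsub>?Q\<^esub>" by (simp add: L.rcos_const)
          then show "a \<in> M'" using a M.one_closed by (simp add: M'_def)
        qed
        obtain X where X: "X \<in> M" "X \<noteq> \<one>\<^bsub>?Q\<^esub>" using M(2) M.one_closed by blast
        then obtain a where a: "a \<in> carrier G" "X = ?\<pi> a" using M.subset surj by blast
        then have "a \<in> M'" "a \<notin> L" using X L.rcos_const by (auto simp: M'_def)
        then show "L \<noteq> M'" by blast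
      qed
      ultimately have "M' \<inter> A \<noteq> {}" by (rule L(3))
      then obtain h where h: "h \<in> H" "inv\<^bsub>G\<^esub> h \<otimes>\<^bsub>G\<^esub> g \<in> M'" by (auto simp: A_def)
      have "g = h \<otimes>\<^bsub>G\<^esub> (inv\<^bsub>G\<^esub> h \<otimes>\<^bsub>G\<^esub> g)" using h(1) g by (simp flip: m_assoc)
      then have "?\<pi> g = ?\<pi> h \<otimes>\<^bsub>?Q\<^esub> ?\<pi> (inv\<^bsub>G\<^esub> h \<otimes>\<^bsub>G\<^esub> g)"
        using \<pi>.hom_mult[of h "inv\<^bsub>G\<^esub> h \<otimes>\<^bsub>G\<^esub> g"] h(1) g by (metis H.mem_carrier inv_closed m_closed)
      then show "\<exists>h \<in> ?\<pi> ` H. \<exists>m \<in> M. ?\<pi> g = h \<otimes>\<^bsub>?Q\<^esub> m"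
        using h by (auto simp: M'_def)
    qed
    \<comment> \<open>Test maps on the quotient are composed with the projection. Their target has a
      carrier type built from cosets, and \<open>dominion_metabelian_nilpotentD\<close> allows it as
      a test group for \<open>G\<close>.\<close>
    moreover have "?\<pi> g \<in> dominion metabelian_nilpotent ?Q (?\<pi> ` H)"
      unfolding dominion_def
    proof (intro CollectI conjI allI impI ballI)
      show "?\<pi> g \<in> carrier ?Q" using g by simp
      fix K :: "('a set + 'a set) list monoid" and f\<^sub>1 f\<^sub>2
      assume K: "metabelian_nilpotent K" "f\<^sub>1 \<in> hom ?Q K" "f\<^sub>2 \<in> hom ?Q K"
        "\<forall>h \<in> ?\<pi> ` H. f\<^sub>1 h = f\<^sub>2 h"
      have "(f\<^sub>1 \<circ> ?\<pi>) g = (f\<^sub>2 \<circ> ?\<pi>) g"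
      proof (rule dominion_metabelian_nilpotentD[OF _ dom K(1)])
        show "group G" by (rule is_group)
        show "f\<^sub>1 \<circ> ?\<pi> \<in> hom G K" "f\<^sub>2 \<circ> ?\<pi> \<in> hom G K"
          using Group.hom_compose[OF \<pi>.homh] K(2,3) by blast+
        show "(f\<^sub>1 \<circ> ?\<pi>) h = (f\<^sub>2 \<circ> ?\<pi>) h" if "h \<in> H" for h
          using K(4) that by simp
      qed
      then show "f\<^sub>1 (?\<pi> g) = f\<^sub>2 (?\<pi> g)" by simp
    qed
    ultimately show False by blast
  qed
qed

end
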